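(* Let $R=[r]\times[s]$, $x\in\mathbb R^R$ and $k\in\mathbb Z_{\ge0}$. (a) If $2\le u\le v\le s$, then $H_{1,u}^{r,v}(x;k)=H_{1,u-1}^{r,v-1}(\mathrm{RSK}^{-1}\circ\mathrm{SWPro}\circ\mathrm{RSK}(x);k)$. (b) If $1\le u\le v\le r-1$, then $H_{u,1}^{v,s}(x;k)=H_{u+1,1}^{v+1,s}(\mathrm{RSK}^{-1}\circ\mathrm{SWPro}\circ\mathrm{RSK}(x);k)$.
   Context: **Toggles, RSK.** $R=[r]\times[s]$ carries the product order, $[n]=\{1,\dots,n\}$; write $p\lessdot q$ for cover relations. For $p\in R$ the toggle $t_p:\mathbb R^R\to\mathbb R^R$ replaces $x_p$ by $\min_{q\gtrdot p}x_q+\max_{q\lessdot p}x_q-x_p$ and fixes all other labels (empty $\max=0$, empty $\min=1$). The transfer map $\phi:\mathbb R^R\to\mathbb R^R$ is the bijection $\phi(x)_p=x_p-\max_{q\lessdot p}x_q$ (empty $\max=0$). For $I\subseteq R$ with $n$ elements and any linear extension $L:I\to[n]$ (order-preserving bijection), $\rho_I=t_{L^{-1}(1)}\circ\cdots\circ t_{L^{-1}(n)}$ (independent of $L$); $\rho_{i,j}=\rho_{[i]\times[j]}$. With $m=\min(r,s)$, $\mathrm{RSK}=\rho^{-1}_{r-m+1,s-m+1}\circ\cdots\circ\rho^{-1}_{r-2,s-2}\circ\rho^{-1}_{r-1,s-1}\circ\phi^{-1}$ (equal to $\phi^{-1}$ if $m=1$). **Striker–Williams promotion.** With $F_k=\{(i,j)\in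 R:i-j=k\}$, $\mathrm{SWPro}=\rho_{F_{1-s}}\circ\rho_{F_{2-s}}\circ\cdots\circ\rho_{F_{r-1}}:\mathbb R^R\to\mathbb R^R$. **Path statistics.** For $u_1\le u_2$, $v_1\le v_2$ and $0\le k\le\min(u_2-u_1+1,v_2-v_1+1)$, $H_{u_1,v_1}^{u_2,v_2}(x;k)$ is the maximum, over all systems of $k$ pairwise vertex-disjoint lattice paths (steps $(1,0)$ and $(0,1)$) from $(u_1,v_1),\dots,(u_1,v_1+k-1)$ to $(u_2,v_2-k+1),\dots,(u_2,v_2)$, of the sum of the labels $x_{ij}$ of all vertices on the paths; for larger $k$ it is constant, equal to its value at $k=\min(u_2-u_1+1,v_2-v_1+1)$. *)

theory Defs
  imports Complex_Main "HOL-Library.FuncSet" "HOL-Library.Product_Order"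
begin

text \<open>On pairs, \<open>\<le>\<close> and \<open><\<close> denote the componentwise (product) order throughout.\<close>

definition grid :: "nat \<Rightarrow> nat \<Rightarrow> (nat \<times> nat) set" where
  "grid r s = {1..r} \<times> {1..s}"

text \<open>The space of real labelings of \<open>R = [r] \<times> [s]\<close>. A labeling is a function that is
  \<open>undefined\<close> off \<open>R\<close>, so that two labelings are equal iff they agree on \<open>R\<close>.\<close>

definition labelings :: "nat \<Rightarrow> nat \<Rightarrow> (nat \<times> nat \<Rightarrow> real) set" where
  "labelings r s = grid r s \<rightarrow>\<^sub>E UNIV"

definition covered_by :: "'a::order set \<Rightarrow> 'a \<Rightarrow> 'a \<Rightarrow> bool" where
  "covered_by P p q \<longleftrightarrow> p \<in> P \<and> q \<in> P \<and> p < q \<and> \<not> (\<exists>z\<in>P. p < z \<and> z < q)"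

definition min_above :: "nat \<Rightarrow> nat \<Rightarrow> (nat \<times> nat \<Rightarrow> real) \<Rightarrow> nat \<times> nat \<Rightarrow> real" where
  "min_above r s x p =
     (let Q = {q. covered_by (grid r s) p q} in if Q = {} then 1 else Min (x ` Q))"

definition max_below :: "nat \<Rightarrow> nat \<Rightarrow> (nat \<times> nat \<Rightarrow> real) \<Rightarrow> nat \<times> nat \<Rightarrow> real" where
  "max_below r s x p =
     (let Q = {q. covered_by (grid r s) q p} in if Q = {} then 0 else Max (x ` Q))"

definition toggle ::
  "nat \<Rightarrow> nat \<Rightarrow> nat \<times> nat \<Rightarrow> (nat \<times> nat \<Rightarrow> real) \<Rightarrow> (nat \<times> nat \<Rightarrow> real)" where
  "toggle r s p x = x(p := min_above r s x p + max_below r s x p - x p)"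

definition transfer ::
  "nat \<Rightarrow> nat \<Rightarrow> (nat \<times> nat \<Rightarrow> real) \<Rightarrow> (nat \<times> nat \<Rightarrow> real)" where
  "transfer r s x = (\<lambda>p\<in>grid r s. x p - max_below r s x p)"

definition linear_extension :: "'a::order set \<Rightarrow> ('a \<Rightarrow> nat) \<Rightarrow> bool" where
  "linear_extension I L \<longleftrightarrow>
     bij_betw L I {1..card I} \<and> (\<forall>p\<in>I. \<forall>q\<in>I. p \<le> q \<longrightarrow> L p \<le> L q)"

definition compose_list :: "('a \<Rightarrow> 'a) list \<Rightarrow> 'a \<Rightarrow> 'a" where
  "compose_list fs = foldr (\<circ>) fs id"

text \<open>The composite does not depend on the linear extension: toggles at elements that are not
  related by a cover commute. Here one extension is fixed by choice.\<close>

definition rho ::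
  "nat \<Rightarrow> nat \<Rightarrow> (nat \<times> nat) set \<Rightarrow> (nat \<times> nat \<Rightarrow> real) \<Rightarrow> (nat \<times> nat \<Rightarrow> real)" where
  "rho r s I =
     (let L = (SOME L. linear_extension I L)
      in compose_list (map (\<lambda>k. toggle r s (inv_into I L k)) [1..<Suc (card I)]))"

definition RSK ::
  "nat \<Rightarrow> nat \<Rightarrow> (nat \<times> nat \<Rightarrow> real) \<Rightarrow> (nat \<times> nat \<Rightarrow> real)" where
  "RSK r s =
     compose_list (map (\<lambda>k. inv_into (labelings r s) (rho r s (grid (r - k) (s - k))))
       (rev [1..<min r s]))
     \<circ> inv_into (labelings r s) (transfer r s)"

definition RSK_inv ::
  "nat \<Rightarrow> nat \<Rightarrow> (nat \<times> nat \<Rightarrow> real) \<Rightarrow> (nat \<times> nat \<Rightarrow> real)" where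
  "RSK_inv r s = inv_into (labelings r s) (RSK r s)"

definition grid_file :: "nat \<Rightarrow> nat \<Rightarrow> int \<Rightarrow> (nat \<times> nat) set" where
  "grid_file r s k = {(i, j) \<in> grid r s. int i - int j = k}"

definition SWPro ::
  "nat \<Rightarrow> nat \<Rightarrow> (nat \<times> nat \<Rightarrow> real) \<Rightarrow> (nat \<times> nat \<Rightarrow> real)" where
  "SWPro r s = compose_list (map (\<lambda>k. rho r s (grid_file r s k)) [1 - int s..int r - 1])"

definition lattice_path :: "(nat \<times> nat) list \<Rightarrow> nat \<times> nat \<Rightarrow> nat \<times> nat \<Rightarrow> bool" where
  "lattice_path \<pi> a b \<longleftrightarrow>
     \<pi> \<noteq> [] \<and> hd \<pi> = a \<and> last \<pi> = b \<and>
     successively (\<lambda>p q. q = (fst p + 1, snd p) \<or> q = (fst p, snd p + 1)) \<pi>"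

text \<open>Systems of \<open>k\<close> vertex-disjoint paths, listed from \<open>0\<close>: path \<open>i\<close> runs from
  \<open>(u1, v1 + i)\<close> to \<open>(u2, v2 - k + 1 + i)\<close>. By planarity this is the only way in which disjoint
  paths can match the sources with the sinks. In the relevant range
  \<open>k \<le> v2 - v1 + 1 \<le> v2 + 1\<close> the natural subtraction is not truncated.\<close>

definition path_systems ::
  "nat \<Rightarrow> nat \<Rightarrow> nat \<Rightarrow> nat \<Rightarrow> nat \<Rightarrow> (nat \<times> nat) list list set" where
  "path_systems u1 v1 u2 v2 k =
     {ps. length ps = k \<and>
          (\<forall>i<k. lattice_path (ps ! i) (u1, v1 + i) (u2, v2 + 1 - k + i)) \<and>
          (\<forall>i<k. \<forall>j<k. i \<noteq> j \<longrightarrow> set (ps ! i) \<inter> set (ps ! j) = {})}"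

definition path_weight :: "(nat \<times> nat \<Rightarrow> real) \<Rightarrow> (nat \<times> nat) list list \<Rightarrow> real" where
  "path_weight x ps = (\<Sum>p \<in> (\<Union>\<pi>\<in>set ps. set \<pi>). x p)"

text \<open>Meaningful for \<open>u1 \<le> u2\<close> and \<open>v1 \<le> v2\<close>; then the set of systems is finite and nonempty.
  Note that the endpoints come before the labeling and \<open>k\<close>.\<close>

definition H ::
  "nat \<Rightarrow> nat \<Rightarrow> nat \<Rightarrow> nat \<Rightarrow> (nat \<times> nat \<Rightarrow> real) \<Rightarrow> nat \<Rightarrow> real" where
  "H u1 v1 u2 v2 x k =
     (let k' = min k (min (u2 - u1 + 1) (v2 - v1 + 1))
      in Max (path_weight x ` path_systems u1 v1 u2 v2 k'))"

end

theory Submission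
  imports Defs "Jordan_Normal_Form.Determinant"
begin

text \<open>
  Give the vertex \<open>p\<close> the weight \<open>exp (\<theta> * x p)\<close>. The generating function of systems of disjoint paths
  is a minor of a matrix of path sums (Lindstroem--Gessel--Viennot), and \<open>H\<close> is its exponential growth
  rate as \<open>\<theta> \<rightarrow> \<infinity>\<close>. Hence every three-term determinant identity with positive terms becomes a max-plus
  identity for \<open>H\<close>. Two such identities suffice.

  A flag Pluecker relation expresses \<open>H\<close> on \<open>[a+1] \<times> [b+1]\<close> through \<open>H\<close> on \<open>[a+1] \<times> [b]\<close>, \<open>[a] \<times> [b+1]\<close>
  and \<open>[a] \<times> [b]\<close>. It is invariant under transposition, hence so is \<open>H\<close>; and for the increments of \<open>H\<close> in
  \<open>k\<close> it is exactly the toggle rule, which gives Greene's theorem for the toggle form of RSK.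

  The Desnanot--Jacobi identity relates \<open>H\<close> on the column intervals \<open>[u,v]\<close>, \<open>[u+1,v+1]\<close>, \<open>[u+1,v]\<close>,
  \<open>[u,v+1]\<close>. For the increments it is the rule by which a sweep of toggles turns the shapes of
  \<open>[1,v]\<close> into those of \<open>[2,v+1]\<close>; so promotion shifts the shapes of \<open>[2,v+1]\<close> to \<open>[1,v]\<close>, and the identity
  itself propagates this to all intervals. Part (b) is part (a) for the transposed inverse map: the
  sweep rule is symmetric under transposition combined with exchanging the old and new labelings.
\<close>

section \<open>Determinants given by lists of rows\<close>

text \<open>A row is a function on all of \<open>nat\<close>, and the length of the list fixes how
  many columns are read. Minors of different sizes can thus be compared by bordering them with unit
  rows.\<close>

definition rows_det :: "(nat \<Rightarrow> real) list \<Rightarrow> real" where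
  "rows_det vs = det (mat (length vs) (length vs) (\<lambda>(i, j). (vs ! i) j))"

lemma rows_det_Nil [simp]: "rows_det [] = 1"
  by (simp add: rows_det_def)

lemma rows_det_swap: "rows_det (us @ x # y # ws) = - rows_det (us @ y # x # ws)"
proof -
  let ?n = "length us + 2 + length ws"
  let ?M = "\<lambda>vs :: (nat \<Rightarrow> real) list. mat ?n ?n (\<lambda>(i, j). (vs ! i) j)"
  have "?M (us @ x # y # ws) = swaprows (length us) (Suc (length us)) (?M (us @ y # x # ws))"
    by (rule eq_matI) (auto simp: nth_append nth_Cons split: nat.splits)
  then have "det (?M (us @ x # y # ws)) = - det (?M (us @ y # x # ws))"
    using det_swaprows[of "length us" ?n "Suc (length us)" "?M (us @ y # x # ws)"] by simp
  then show ?thesis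
    by (simp add: rows_det_def)
qed

lemma rows_det_same:
  assumes "i < length vs" "j < length vs" "i \<noteq> j" "vs ! i = vs ! j"
  shows "rows_det vs = 0"
  unfolding rows_det_def
  by (rule det_identical_rows[OF _ assms(3,1,2)]) (use assms in \<open>auto simp: row_def\<close>)

text \<open>Laplace expansion along the distinguished row. Its cofactors depend on \<open>us\<close>
  and \<open>ws\<close> only, hence the order of the quantifiers.\<close>

lemma rows_det_linear:
  "\<exists>c. \<forall>v. rows_det (us @ v # ws) = (\<Sum>j < length us + 1 + length ws. v j * c j)"
proof -
  let ?n = "length us + 1 + length ws"
  let ?M = "\<lambda>v. mat ?n ?n (\<lambda>(i, j). ((us @ v # ws) ! i) j)"
  let ?c = "\<lambda>j. cofactor (?M (\<lambda>_. 0)) (length us) j"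
  have "rows_det (us @ v # ws) = (\<Sum>j<?n. v j * ?c j)" for v
  proof -
    have "rows_det (us @ v # ws) = det (?M v)"
      by (simp add: rows_det_def)
    also have "\<dots> = (\<Sum>j<?n. ?M v $$ (length us, j) * cofactor (?M v) (length us) j)"
      by (rule laplace_expansion_row) auto
    also have "\<dots> = (\<Sum>j<?n. v j * ?c j)"
    proof (rule sum.cong[OF refl])
      fix j assume "j \<in> {..<?n}"
      have "mat_delete (?M v) (length us) j = mat_delete (?M (\<lambda>_. 0)) (length us) j"
        by (rule eq_matI) (auto simp: mat_delete_def nth_append nth_Cons split: nat.splits)
      then show "?M v $$ (length us, j) * cofactor (?M v) (length us) j = v j * ?c j"
        using \<open>j \<in> {..<?n}\<close> by (simp add: cofactor_def)
    qed
    finally show ?thesis .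
  qed
  then show ?thesis by blast
qed

lemma rows_det_add_scale:
  assumes "\<And>j. v j = \<alpha> * (p j + q j)"
  shows "rows_det (us @ v # ws) = \<alpha> * (rows_det (us @ p # ws) + rows_det (us @ q # ws))"
proof -
  obtain c where "\<And>v. rows_det (us @ v # ws) = (\<Sum>j < length us + 1 + length ws. v j * c j)"
    using rows_det_linear by blast
  then show ?thesis
    by (simp add: assms sum.distrib sum_distrib_left algebra_simps del: sum.lessThan_Suc)
qed

lemma rows_det_sum:
  assumes "\<And>j. j < length us + 1 + length ws \<Longrightarrow> v j = (\<Sum>i\<in>I. a i * f i j)"
  shows "rows_det (us @ v # ws) = (\<Sum>i\<in>I. a i * rows_det (us @ f i # ws))"
proof -
  obtain c where c: "\<And>v. rows_det (us @ v # ws) = (\<Sum>j < length us + 1 + length ws. v j * c j)"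
    using rows_det_linear by blast
  have "(\<Sum>j < length us + 1 + length ws. v j * c j) =
        (\<Sum>j < length us + 1 + length ws. \<Sum>i\<in>I. a i * (f i j * c j))"
    by (rule sum.cong[OF refl]) (simp add: assms sum_distrib_right mult.assoc)
  also have "\<dots> = (\<Sum>i\<in>I. a i * (\<Sum>j < length us + 1 + length ws. f i j * c j))"
    by (subst sum.swap) (simp add: sum_distrib_left del: sum.lessThan_Suc)
  finally show ?thesis by (simp only: c)
qed

lemma rows_det_zero_row:
  assumes "i < length vs" "\<And>j. j < length vs \<Longrightarrow> (vs ! i) j = 0"
  shows "rows_det vs = 0"
proof -
  have "rows_det (take i vs @ (vs ! i) # drop (Suc i) vs) =
        (\<Sum>k\<in>({}::nat set). 0 * rows_det (take i vs @ (\<lambda>_. 0) # drop (Suc i) vs))"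
    by (rule rows_det_sum) (use assms in auto)
  then show ?thesis
    using assms(1) by (simp add: id_take_nth_drop[symmetric])
qed

lemma rows_det_move:
  "rows_det (us @ x # ws @ zs) = (- 1) ^ length ws * rows_det (us @ ws @ x # zs)"
proof (induction ws arbitrary: us)
  case (Cons w ws)
  have "rows_det (us @ x # (w # ws) @ zs) = - rows_det ((us @ [w]) @ x # ws @ zs)"
    using rows_det_swap[of us x w "ws @ zs"] by simp
  then show ?case
    by (simp only: Cons.IH) simp
qed simp

text \<open>Expansion along the unit row. Read backwards, it pads a minor by one row and one column,
  so that it can enter a relation between larger minors.\<close>

lemma rows_det_last_unit:
  assumes "\<And>j. j < length vs \<Longrightarrow> e j = 0" "e (length vs) = 1"
  shows "rows_det (vs @ [e]) = rows_det vs"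
proof -
  let ?n = "length vs"
  let ?M = "mat (Suc ?n) (Suc ?n) (\<lambda>(i, j). ((vs @ [e]) ! i) j)"
  have "rows_det (vs @ [e]) = det ?M"
    by (simp add: rows_det_def)
  also have "\<dots> = (\<Sum>j<Suc ?n. ?M $$ (?n, j) * cofactor ?M ?n j)"
    by (rule laplace_expansion_row) auto
  also have "\<dots> = cofactor ?M ?n ?n"
    using assms by simp
  also have "mat_delete ?M ?n ?n = mat ?n ?n (\<lambda>(i, j). (vs ! i) j)"
    by (rule eq_matI) (auto simp: mat_delete_def nth_append)
  then have "cofactor ?M ?n ?n = rows_det vs"
    by (simp add: cofactor_def rows_det_def)
  finally show ?thesis .
qed

text \<open>The unit row deletes column 0. For path matrices this drops the first source, that is,
  it raises \<open>v0\<close> by one.\<close>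

lemma rows_det_first_unit:
  assumes "\<And>j. e (Suc j) = 0" "e 0 = 1"
  shows "rows_det (e # vs) = rows_det (map (\<lambda>v j. v (Suc j)) vs)"
proof -
  let ?n = "length vs"
  let ?M = "mat (Suc ?n) (Suc ?n) (\<lambda>(i, j). ((e # vs) ! i) j)"
  have "rows_det (e # vs) = det ?M"
    by (simp add: rows_det_def)
  also have "\<dots> = (\<Sum>j<Suc ?n. ?M $$ (0, j) * cofactor ?M 0 j)"
    by (rule laplace_expansion_row) auto
  also have "\<dots> = cofactor ?M 0 0"
    using assms by (subst sum.lessThan_Suc_shift) simp
  also have "mat_delete ?M 0 0 = mat ?n ?n (\<lambda>(i, j). (map (\<lambda>v j. v (Suc j)) vs ! i) j)"
    by (rule eq_matI) (auto simp: mat_delete_def)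
  then have "cofactor ?M 0 0 = rows_det (map (\<lambda>v j. v (Suc j)) vs)"
    by (simp add: cofactor_def rows_det_def)
  finally show ?thesis .
qed

lemma rows_det_lower_triangular:
  assumes "\<And>i j. i < j \<Longrightarrow> j < length vs \<Longrightarrow> (vs ! i) j = 0"
  shows "rows_det vs = (\<Prod>i<length vs. (vs ! i) i)"
proof -
  let ?n = "length vs"
  let ?M = "mat ?n ?n (\<lambda>(i, j). (vs ! i) j)"
  have "det ?M = prod_list (diag_mat ?M)"
    by (rule det_lower_triangular[of ?n]) (use assms in auto)
  also have "\<dots> = prod_list (map (\<lambda>i. (vs ! i) i) [0..<?n])"
    by (auto simp: diag_mat_def intro!: arg_cong[of _ _ prod_list])
  also have "\<dots> = (\<Prod>i<?n. (vs ! i) i)"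
    by (simp add: prod.distinct_set_conv_list[symmetric] atLeast0LessThan)
  finally show ?thesis by (simp add: rows_det_def)
qed

lemma rows_det_basis:
  assumes "rows_det vs \<noteq> 0"
  obtains c where "\<And>j. j < length vs \<Longrightarrow> v j = (\<Sum>i<length vs. c i * (vs ! i) j)"
proof -
  let ?n = "length vs"
  define M where "M = mat ?n ?n (\<lambda>(i, j). (vs ! i) j)"
  have M: "M \<in> carrier_mat ?n ?n" by (simp add: M_def)
  \<comment> \<open>Cramer's rule in adjugate form: \<open>c\<close> is the row vector
    \<open>v\<close> times the inverse of \<open>M\<close>.\<close>
  define c where "c = (\<lambda>i. (\<Sum>k<?n. v k * adj_mat M $$ (k, i)) / det M)"
  have d: "det M \<noteq> 0" using assms by (simp add: rows_det_def M_def)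
  have "v j = (\<Sum>i<?n. c i * (vs ! i) j)" if j: "j < ?n" for j
  proof -
    have am: "(\<Sum>i<?n. adj_mat M $$ (k, i) * M $$ (i, j)) = (if k = j then det M else 0)"
      if "k < ?n" for k
    proof -
      have "(adj_mat M * M) $$ (k, j) = (det M \<cdot>\<^sub>m 1\<^sub>m ?n) $$ (k, j)"
        using adj_mat(3)[OF M] by simp
      moreover have "(adj_mat M * M) $$ (k, j) = (\<Sum>i<?n. adj_mat M $$ (k, i) * M $$ (i, j))"
        using that j M adj_mat(1)[OF M]
        by (auto simp: scalar_prod_def atLeast0LessThan intro!: sum.cong)
      ultimately show ?thesis using that j by simp
    qed
    have "det M * (\<Sum>i<?n. c i * (vs ! i) j) =
          (\<Sum>i<?n. \<Sum>k<?n. v k * (adj_mat M $$ (k, i) * M $$ (i, j)))"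
      unfolding sum_distrib_left
      by (rule sum.cong[OF refl])
         (use d j in \<open>simp add: c_def M_def sum_distrib_right mult.assoc\<close>)
    also have "\<dots> = (\<Sum>k<?n. v k * (\<Sum>i<?n. adj_mat M $$ (k, i) * M $$ (i, j)))"
      by (subst sum.swap) (simp add: sum_distrib_left)
    also have "\<dots> = (\<Sum>k<?n. if k = j then v k * det M else 0)"
      by (rule sum.cong[OF refl]) (auto simp: am)
    also have "\<dots> = det M * v j" using j by simp
    finally show ?thesis using d by simp
  qed
  then show ?thesis by (rule that)
qed

text \<open>If some bracket is nonzero, its rows form a basis; modulo the common rows \<open>S\<close> every vector is
  a combination of two fixed ones, and the relation becomes the one between \<open>2 \<times> 2\<close> minors.\<close>

lemma rows_det_plucker:
  fixes S :: "(nat \<Rightarrow> real) list"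
  defines "B \<equiv> \<lambda>p q. rows_det (p # S @ [q])"
  shows "B a b * B c d - B a c * B b d + B a d * B b c = 0"
proof (cases "\<forall>p q. B p q = 0")
  case True
  then show ?thesis by simp
next
  case False
  then obtain p q where pq: "B p q \<noteq> 0" by blast
  let ?vs = "p # S @ [q]"
  let ?n = "length ?vs"
  have ex: "\<exists>\<alpha> \<beta>. \<forall>w. B v w = \<alpha> * B p w + \<beta> * B q w" for v
  proof -
    obtain \<gamma> where \<gamma>: "\<And>j. j < ?n \<Longrightarrow> v j = (\<Sum>i<?n. \<gamma> i * (?vs ! i) j)"
      using rows_det_basis[of ?vs v] pq unfolding B_def by blast
    have "B v w = \<gamma> 0 * B p w + \<gamma> (Suc (length S)) * B q w" for w
    proof -
      have "B v w = (\<Sum>i<?n. \<gamma> i * B (?vs ! i) w)"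
        unfolding B_def
        using rows_det_sum[of "[]" "S @ [w]" v \<gamma> "\<lambda>i. ?vs ! i" "{..<?n}"] \<gamma>
        by (simp del: sum.lessThan_Suc)
      also have "\<dots> = \<gamma> 0 * B p w + (\<Sum>i<length S. \<gamma> (Suc i) * B (S ! i) w)
                       + \<gamma> (Suc (length S)) * B q w"
        by (simp add: sum.lessThan_Suc_shift[of _ "Suc (length S)"] nth_append
            del: sum.lessThan_Suc) (simp add: nth_append)
      \<comment> \<open>A row of \<open>S\<close> put in the first place occurs twice.\<close>
      also have "(\<Sum>i<length S. \<gamma> (Suc i) * B (S ! i) w) = 0"
      proof (rule sum.neutral, clarify)
        fix i assume "i < length S"
        then have "rows_det (S ! i # S @ [w]) = 0"
          by (intro rows_det_same[of 0 _ "Suc i"]) (auto simp: nth_append)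
        then show "\<gamma> (Suc i) * B (S ! i) w = 0" by (simp add: B_def)
      qed
      finally show ?thesis by simp
    qed
    then show ?thesis by blast
  qed
  \<comment> \<open>Antisymmetry: passing \<open>S\<close> costs the same sign in both orders, and
    exchanging the last two rows costs one more.\<close>
  have sw: "B v w = - B w v" for v w
  proof -
    have "B v w = (- 1) ^ length S * rows_det (S @ [v, w])"
      using rows_det_move[of "[]" v S "[w]"] by (simp add: B_def)
    moreover have "B w v = (- 1) ^ length S * rows_det (S @ [w, v])"
      using rows_det_move[of "[]" w S "[v]"] by (simp add: B_def)
    ultimately show ?thesis
      using rows_det_swap[of S v w "[]"] by simp
  qed
  have z: "B v v = 0" for v using sw[of v v] by simp
  have ev: "\<exists>\<alpha> \<beta>. \<forall>w. B v w = \<alpha> * B p w + \<beta> * B q w \<and> B w v = \<alpha> * B w p + \<beta> * B w q" for v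
    using ex[of v] sw by (metis add.inverse_distrib_swap add.commute mult_minus_right)
  obtain a1 a2 where A: "\<And>w. B a w = a1 * B p w + a2 * B q w" "\<And>w. B w a = a1 * B w p + a2 * B w q"
    using ev[of a] by blast
  obtain b1 b2 where B: "\<And>w. B b w = b1 * B p w + b2 * B q w" "\<And>w. B w b = b1 * B w p + b2 * B w q"
    using ev[of b] by blast
  obtain c1 c2 where C: "\<And>w. B c w = c1 * B p w + c2 * B q w" "\<And>w. B w c = c1 * B w p + c2 * B w q"
    using ev[of c] by blast
  obtain d1 d2 where D: "\<And>w. B d w = d1 * B p w + d2 * B q w" "\<And>w. B w d = d1 * B w p + d2 * B w q"
    using ev[of d] by blast
  have qp: "B q p = - B p q" by (rule sw)
  show ?thesis
    by (simp add: A(1) B(1) C(1) B(2) C(2) D(2) z qp) (simp add: algebra_simps)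
qed

section \<open>Lattice paths and determinants\<close>

lemma lattice_path_bounds:
  assumes "lattice_path \<pi> a b" "p \<in> set \<pi>"
  shows "a \<le> p \<and> p \<le> b"
  using assms
proof (induction \<pi> arbitrary: a p)
  case (Cons q \<pi>)
  show ?case
  proof (cases \<pi>)
    case Nil
    then show ?thesis using Cons.prems by (auto simp: lattice_path_def)
  next
    case (Cons q' \<pi>')
    then have *: "lattice_path \<pi> q' b" "q = a" "a \<le> q'"
      using Cons.prems(1)
      by (auto simp: lattice_path_def successively_Cons less_eq_prod_def)
    have "q' \<le> b"
      using Cons.IH[OF *(1), of q'] Cons by simp
    then show ?thesis
      using Cons.IH[OF *(1), of p] Cons.prems(2) * by fastforce
  qed
qed (simp add: lattice_path_def)

lemma lattice_path_snoc:
  assumes "\<pi> \<noteq> []"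
  shows "lattice_path (\<pi> @ [q]) a b \<longleftrightarrow>
    q = b \<and> (\<exists>l. lattice_path \<pi> a l \<and> (q = (fst l + 1, snd l) \<or> q = (fst l, snd l + 1)))"
  using assms by (auto simp: lattice_path_def successively_append_iff)

text \<open>For positive \<open>a\<close> and \<open>c\<close>, the weighted sum over the lattice
  paths from \<open>(1, c)\<close> to \<open>(a, b)\<close>. The 1 in row 0 stands for the empty
  path just above the source.\<close>

fun path_sum :: "(nat \<Rightarrow> nat \<Rightarrow> real) \<Rightarrow> nat \<Rightarrow> nat \<Rightarrow> nat \<Rightarrow> real" where
  "path_sum w c 0 b = (if b = c then 1 else 0)"
| "path_sum w c (Suc a) 0 = 0"
| "path_sum w c (Suc a) (Suc b) =
     w (Suc a) (Suc b) * (path_sum w c a (Suc b) + path_sum w c (Suc a) b)"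

text \<open>Rows are counted from \<open>u0\<close>. Row \<open>0\<close> lies just above the first row and only serves to start the
  recursion: a path that ends there is empty.\<close>

definition path_to :: "nat \<Rightarrow> nat \<Rightarrow> nat \<times> nat \<Rightarrow> (nat \<times> nat) list \<Rightarrow> bool" where
  "path_to u0 c q \<pi> \<longleftrightarrow>
     (if fst q = 0 then \<pi> = [] \<and> snd q = c
      else lattice_path \<pi> (Suc u0, c) (u0 + fst q, snd q))"

lemma path_to_bounds:
  assumes "path_to u0 c q \<pi>" "p \<in> set \<pi>"
  shows "fst p \<le> u0 + fst q \<and> snd p \<le> snd q"
  using assms lattice_path_bounds[of \<pi> "(Suc u0, c)" "(u0 + fst q, snd q)" p]
  by (auto simp: path_to_def less_eq_prod_def split: if_splits)

lemma path_to_last: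
  assumes "path_to u0 c q \<pi>" "0 < fst q"
  shows "\<pi> \<noteq> [] \<and> last \<pi> = (u0 + fst q, snd q)"
  using assms by (auto simp: path_to_def lattice_path_def)

text \<open>Removal of the last vertex. Thanks to row 0 the one-vertex path arises from the empty
  path, so the decomposition has no exceptional case.\<close>

lemma path_to_step:
  "path_to u0 c (Suc a, Suc b) \<pi> \<longleftrightarrow>
     (\<exists>\<pi>'. \<pi> = \<pi>' @ [(u0 + Suc a, Suc b)] \<and>
           (path_to u0 c (a, Suc b) \<pi>' \<or> path_to u0 c (Suc a, b) \<pi>'))"
  (is "?L \<longleftrightarrow> (\<exists>\<pi>'. ?R \<pi>')")
proof
  assume L: ?L
  then have lp: "lattice_path \<pi> (Suc u0, c) (u0 + Suc a, Suc b)"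
    by (simp add: path_to_def)
  obtain \<pi>' where \<pi>': "\<pi> = \<pi>' @ [(u0 + Suc a, Suc b)]"
    using path_to_last[OF L] by (metis append_butlast_last_id fst_conv snd_conv zero_less_Suc)
  have "?R \<pi>'"
  proof (cases "\<pi>' = []")
    case True
    then show ?thesis using lp \<pi>' by (auto simp: path_to_def lattice_path_def)
  next
    case False
    then obtain l where l: "lattice_path \<pi>' (Suc u0, c) l"
        "(u0 + Suc a, Suc b) = (fst l + 1, snd l) \<or> (u0 + Suc a, Suc b) = (fst l, snd l + 1)"
      using lp unfolding \<pi>' lattice_path_snoc[OF False] by blast
    \<comment> \<open>\<open>l\<close> is a vertex, hence not in the virtual row 0: arriving from
      above forces \<open>0 < a\<close>.\<close>
    have "l \<in> set \<pi>'" using l(1) by (auto simp: lattice_path_def)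
    then have "Suc u0 \<le> fst l"
      using lattice_path_bounds[OF l(1)] by (simp add: less_eq_prod_def)
    then show ?thesis
      using l \<pi>' by (cases l) (auto simp: path_to_def)
  qed
  then show "\<exists>\<pi>'. ?R \<pi>'" ..
next
  assume "\<exists>\<pi>'. ?R \<pi>'"
  then obtain \<pi>' where R: "?R \<pi>'" ..
  show ?L
  proof (cases "\<pi>' = []")
    case True
    then show ?thesis using R by (auto simp: path_to_def lattice_path_def split: if_splits)
  next
    case False
    then show ?thesis using R
      by (auto simp: path_to_def lattice_path_snoc split: if_splits)
  qed
qed

text \<open>Arbitrary sinks are allowed because the recursion moves one sink at a time, possibly
  into row 0; the sources remain consecutive, starting in column \<open>Suc v0\<close>.\<close>

definition systems_to :: "nat \<Rightarrow> nat \<Rightarrow> (nat \<times> nat) list \<Rightarrow> (nat \<times> nat) list list set" where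
  "systems_to u0 v0 qs =
     {ps. length ps = length qs \<and>
          (\<forall>i<length qs. path_to u0 (Suc v0 + i) (qs ! i) (ps ! i)) \<and>
          (\<forall>i<length qs. \<forall>j<length qs. i \<noteq> j \<longrightarrow> set (ps ! i) \<inter> set (ps ! j) = {})}"

definition system_weight :: "(nat \<times> nat \<Rightarrow> real) \<Rightarrow> (nat \<times> nat) list list \<Rightarrow> real" where
  "system_weight W ps = (\<Prod>p \<in> (\<Union>\<pi>\<in>set ps. set \<pi>). W p)"

text \<open>The Lindstroem--Gessel--Viennot determinant, with one row per sink and one column per
  source.\<close>

definition sinks_det :: "(nat \<Rightarrow> nat \<Rightarrow> real) \<Rightarrow> nat \<Rightarrow> (nat \<times> nat) list \<Rightarrow> real" where
  "sinks_det w v0 qs = rows_det (map (\<lambda>q i. path_sum w (Suc v0 + i) (fst q) (snd q)) qs)"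

text \<open>The position of the sinks that keeps the vertex removed in the recursion away from all
  other paths.\<close>

definition staircase :: "(nat \<times> nat) list \<Rightarrow> bool" where
  "staircase qs \<longleftrightarrow>
     (\<forall>j<length qs. \<forall>i<j. fst (qs ! j) \<le> fst (qs ! i) \<and> snd (qs ! i) < snd (qs ! j))"

text \<open>The sink that moves is the last one in its row. Its vertex \<open>q\<close> is entered
  from above or from the left, and \<open>f\<close> appends \<open>q\<close> again.\<close>

lemma systems_to_step:
  fixes us ws :: "(nat \<times> nat) list" and u0 v0 a b :: nat
  defines "n \<equiv> length us" and "q \<equiv> (u0 + Suc a, Suc b)"
  defines "qs \<equiv> us @ (Suc a, Suc b) # ws"
    and "Up \<equiv> systems_to u0 v0 (us @ (a, Suc b) # ws)"
    and "Lt \<equiv> systems_to u0 v0 (us @ (Suc a, b) # ws)"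
    and "f \<equiv> (\<lambda>ps :: (nat \<times> nat) list list. ps[n := ps ! n @ [q]])"
  assumes st: "staircase qs" and ws: "\<forall>q\<in>set ws. fst q \<le> a"
  shows "systems_to u0 v0 qs = f ` (Up \<union> Lt)"
    and "inj_on f (Up \<union> Lt)" and "Up \<inter> Lt = {}"
    and "\<And>ps. ps \<in> Up \<union> Lt \<Longrightarrow> system_weight W (f ps) = W q * system_weight W ps"
proof -
  have len: "length ps = n + 1 + length ws" if "ps \<in> Up \<union> Lt" for ps
    using that by (auto simp: Up_def Lt_def systems_to_def n_def)
  have path: "path_to u0 (Suc v0 + i) (qs ! i) (ps ! i)"
    if "ps \<in> Up \<union> Lt" "i < n + 1 + length ws" "i \<noteq> n" for ps i
  proof -
    have "path_to u0 (Suc v0 + i) ((us @ (a, Suc b) # ws) ! i) (ps ! i) \<or>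
          path_to u0 (Suc v0 + i) ((us @ (Suc a, b) # ws) ! i) (ps ! i)"
      using that(1,2) by (auto simp: Up_def Lt_def systems_to_def n_def)
    moreover have "(us @ (a, Suc b) # ws) ! i = qs ! i" "(us @ (Suc a, b) # ws) ! i = qs ! i"
      using that(3) by (auto simp: qs_def n_def nth_append nth_Cons split: nat.split)
    ultimately show ?thesis by metis
  qed
  have pathn: "path_to u0 (Suc v0 + n) (a, Suc b) (ps ! n)" if "ps \<in> Up" for ps
    using that by (auto simp: Up_def systems_to_def n_def dest!: spec[of _ "length us"])
  have pathn': "path_to u0 (Suc v0 + n) (Suc a, b) (ps ! n)" if "ps \<in> Lt" for ps
    using that by (auto simp: Lt_def systems_to_def n_def dest!: spec[of _ "length us"])
  have disj: "set (ps ! i) \<inter> set (ps ! j) = {}"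
    if "ps \<in> Up \<union> Lt" "i < n + 1 + length ws" "j < n + 1 + length ws" "i \<noteq> j" for ps i j
    using that by (auto simp: Up_def Lt_def systems_to_def n_def)
  have qn: "qs ! n = (Suc a, Suc b)" by (simp add: qs_def n_def)
  have lenq: "length qs = n + 1 + length ws" by (simp add: qs_def n_def)
  \<comment> \<open>Earlier sinks lie in columns to the left of \<open>q\<close>, later ones in rows
    above it, and a path never goes beyond its sink.\<close>
  have new: "q \<notin> set (ps ! i)" if ps: "ps \<in> Up \<union> Lt" and i: "i < n + 1 + length ws" for ps i
  proof
    assume q: "q \<in> set (ps ! i)"
    consider "i < n" | "i = n" | "n < i" by linarith
    then show False
    proof cases
      case 1
      then have "snd (qs ! i) < Suc b"
        using st qn lenq unfolding staircase_def by (metis add_gr_0 less_add_same_cancel1 less_one snd_conv add.assoc)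
      then show False
        using path_to_bounds[OF path[OF ps i] q] 1 by (simp add: q_def)
    next
      case 2
      then show False
        using ps q path_to_bounds[OF pathn, of ps q] path_to_bounds[OF pathn', of ps q]
        by (auto simp: q_def)
    next
      case 3
      then have "qs ! i \<in> set ws"
        using i by (auto simp: qs_def n_def nth_append nth_Cons split: nat.split)
      then have "fst (qs ! i) \<le> a" using ws by blast
      then show False
        using path_to_bounds[OF path[OF ps i] q] 3 by (simp add: q_def)
    qed
  qed
  \<comment> \<open>The final vertices of path \<open>n\<close> differ; if \<open>a\<close> is 0,
    that path is empty in \<open>Up\<close> but not in \<open>Lt\<close>.\<close>
  show "Up \<inter> Lt = {}"
  proof (rule ccontr)
    assume "Up \<inter> Lt \<noteq> {}"
    then obtain ps where "ps \<in> Up" "ps \<in> Lt" by blast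
    then show False
      using pathn[of ps] pathn'[of ps] path_to_last[OF pathn, of ps] path_to_last[OF pathn', of ps]
      by (cases a) (auto simp: path_to_def)
  qed
  show "inj_on f (Up \<union> Lt)"
  proof (rule inj_onI)
    fix ps ps' assume ps: "ps \<in> Up \<union> Lt" "ps' \<in> Up \<union> Lt" and eq: "f ps = f ps'"
    show "ps = ps'"
    proof (rule nth_equalityI)
      show "length ps = length ps'" using ps by (simp add: len)
      fix i assume i: "i < length ps"
      have "f ps ! i = f ps' ! i" using eq by simp
      then show "ps ! i = ps' ! i"
        using i len[OF ps(1)] len[OF ps(2)] by (cases "i = n") (auto simp: f_def)
    qed
  qed
  show "system_weight W (f ps) = W q * system_weight W ps" if ps: "ps \<in> Up \<union> Lt" for ps
  proof -
    have U: "(\<Union>\<pi>\<in>set xs. set \<pi>) = (\<Union>i<length xs. set (xs ! i))" for xs :: "(nat \<times> nat) list list"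
    proof -
      have "set xs = (!) xs ` {..<length xs}" by (auto simp: set_conv_nth)
      then show ?thesis by simp
    qed
    have "(\<Union>\<pi>\<in>set (f ps). set \<pi>) = insert q (\<Union>\<pi>\<in>set ps. set \<pi>)"
      unfolding U using len[OF ps]
      by (auto simp: f_def nth_list_update split: if_splits intro!: bexI[of _ n])
    moreover have "q \<notin> (\<Union>\<pi>\<in>set ps. set \<pi>)"
      unfolding U using new[OF ps] len[OF ps] by auto
    ultimately show ?thesis by (simp add: system_weight_def)
  qed
  show "systems_to u0 v0 qs = f ` (Up \<union> Lt)"
  proof (intro equalityI subsetI)
    fix ps assume ps: "ps \<in> systems_to u0 v0 qs"
    have l: "length ps = n + 1 + length ws"
      using ps by (simp add: systems_to_def lenq)
    have "path_to u0 (Suc v0 + n) (Suc a, Suc b) (ps ! n)"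
    proof -
      have "n < length qs" by (simp add: lenq)
      then have "path_to u0 (Suc v0 + n) (qs ! n) (ps ! n)" using ps by (simp add: systems_to_def)
      then show ?thesis by (simp only: qn)
    qed
    then obtain \<pi> where \<pi>: "ps ! n = \<pi> @ [q]"
      "path_to u0 (Suc v0 + n) (a, Suc b) \<pi> \<or> path_to u0 (Suc v0 + n) (Suc a, b) \<pi>"
      unfolding path_to_step q_def by blast
    have "ps = f (ps[n := \<pi>])" using \<pi>(1) l by (simp add: f_def flip: \<pi>(1))
    moreover have "ps[n := \<pi>] \<in> Up \<union> Lt"
    proof -
      have d: "set (ps[n := \<pi>] ! i) \<inter> set (ps[n := \<pi>] ! j) = {}"
        if "i < length qs" "j < length qs" "i \<noteq> j" for i j
      proof -
        have "set (ps ! i) \<inter> set (ps ! j) = {}" using ps that by (simp add: systems_to_def)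
        moreover have "set (ps[n := \<pi>] ! k) \<subseteq> set (ps ! k)" if "k < length qs" for k
          using that \<pi>(1) l lenq by (cases "k = n") auto
        ultimately show ?thesis using that by blast
      qed
      have p: "path_to u0 (Suc v0 + i) ((us @ x # ws) ! i) (ps[n := \<pi>] ! i)"
        if "i < length qs" "path_to u0 (Suc v0 + n) x \<pi>" for i x
      proof (cases "i = n")
        case True
        then show ?thesis using that l lenq by (simp add: n_def)
      next
        case False
        then have "(us @ x # ws) ! i = qs ! i"
          by (auto simp: qs_def n_def nth_append nth_Cons split: nat.split)
        then show ?thesis using ps that False by (simp add: systems_to_def)
      qed
      have "ps[n := \<pi>] \<in> systems_to u0 v0 (us @ x # ws)"
        if x: "path_to u0 (Suc v0 + n) x \<pi>" for x
      proof -
        have "length (us @ x # ws) = length qs" by (simp add: qs_def)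
        then show ?thesis
          unfolding systems_to_def mem_Collect_eq using l lenq d p[OF _ x] by simp
      qed
      then show ?thesis using \<pi>(2) by (auto simp: Up_def Lt_def)
    qed
    ultimately show "ps \<in> f ` (Up \<union> Lt)" by blast
  next
    fix ps' assume "ps' \<in> f ` (Up \<union> Lt)"
    then obtain ps where ps: "ps \<in> Up \<union> Lt" "ps' = f ps" by blast
    have "path_to u0 (Suc v0 + n) (Suc a, Suc b) (ps ! n @ [q])"
      unfolding path_to_step using ps(1) pathn pathn' by (auto simp: q_def)
    then have "path_to u0 (Suc v0 + i) (qs ! i) (f ps ! i)" if "i < length qs" for i
      using path[OF ps(1)] that len[OF ps(1)] lenq qn by (cases "i = n") (auto simp: f_def)
    moreover have "set (f ps ! i) \<inter> set (f ps ! j) = {}"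
      if "i < length qs" "j < length qs" "i \<noteq> j" for i j
      using disj[OF ps(1), of i j] new[OF ps(1), of i] new[OF ps(1), of j] that len[OF ps(1)] lenq
      by (auto simp: f_def nth_list_update)
    ultimately show "ps' \<in> systems_to u0 v0 qs"
      using len[OF ps(1)] lenq ps(2) by (simp add: systems_to_def f_def)
  qed
qed

lemma sinks_det_step:
  "sinks_det w v0 (us @ (Suc a, Suc b) # ws) =
     w (Suc a) (Suc b) * (sinks_det w v0 (us @ (a, Suc b) # ws) + sinks_det w v0 (us @ (Suc a, b) # ws))"
  unfolding sinks_det_def map_append list.map by (rule rows_det_add_scale) simp

lemma sinks_det_same:
  assumes "i < length qs" "j < length qs" "i \<noteq> j" "qs ! i = qs ! j"
  shows "sinks_det w v0 qs = 0"
  unfolding sinks_det_def by (rule rows_det_same[of i _ j]) (use assms in auto)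

lemma sinks_det_zero_row:
  assumes "i < length qs"
    and "\<And>j. j < length qs \<Longrightarrow> path_sum w (Suc v0 + j) (fst (qs ! i)) (snd (qs ! i)) = 0"
  shows "sinks_det w v0 qs = 0"
  unfolding sinks_det_def by (rule rows_det_zero_row[of i]) (use assms in auto)

text \<open>Only empty paths occur. If every sink stands on its own source, the matrix is the
  identity; otherwise some sink is outside the range of the source columns and gives a zero
  row.\<close>

lemma systems_to_eq_det_base:
  assumes st: "staircase qs" and z: "\<forall>q\<in>set qs. fst q = 0"
  shows "finite (systems_to u0 v0 qs) \<and>
    (\<Sum>ps\<in>systems_to u0 v0 qs. system_weight W ps) = sinks_det w v0 qs"
proof -
  let ?k = "length qs"
  have z': "fst (qs ! i) = 0" if "i < ?k" for i using z that by simp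
  show ?thesis
  proof (cases "\<forall>i<?k. snd (qs ! i) = Suc v0 + i")
    case True
    then have S: "systems_to u0 v0 qs = {replicate ?k []}"
      using z' by (auto simp: systems_to_def path_to_def intro: nth_equalityI)
    have "sinks_det w v0 qs = (\<Prod>i<length qs. 1)"
      unfolding sinks_det_def by (subst rows_det_lower_triangular) (use True z' in auto)
    moreover have "system_weight W (replicate ?k []) = 1"
      by (cases "?k = 0") (simp_all add: system_weight_def)
    ultimately show ?thesis by (simp add: S)
  next
    case False
    have S: "systems_to u0 v0 qs = {}"
      using False z' by (fastforce simp: systems_to_def path_to_def)
    have mono: "snd (qs ! i) + d \<le> snd (qs ! (i + d))" if "i + d < ?k" for i d
      using that
    proof (induction d)
      case (Suc d)
      have "snd (qs ! (i + d)) < snd (qs ! (i + Suc d))"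
        using st Suc.prems by (auto simp: staircase_def)
      then show ?case using Suc by simp
    qed simp
    obtain i0 where i0: "i0 < ?k" "snd (qs ! i0) \<noteq> Suc v0 + i0" using False by blast
    \<comment> \<open>Columns increase strictly, so a deviation to the left forces the first sink
      out of the range, and one to the right forces the last sink out.\<close>
    have "\<exists>i<?k. snd (qs ! i) < Suc v0 \<or> v0 + ?k < snd (qs ! i)"
    proof (cases "snd (qs ! i0) < Suc v0 + i0")
      case True
      then show ?thesis using mono[of 0 i0] i0 by (intro exI[of _ 0]) auto
    next
      case False
      moreover have "qs \<noteq> []" using i0(1) by auto
      ultimately show ?thesis
        using mono[of i0 "?k - 1 - i0"] i0 by (intro exI[of _ "?k - 1"]) auto
    qed
    then obtain i where i: "i < ?k" "snd (qs ! i) < Suc v0 \<or> v0 + ?k < snd (qs ! i)" by blast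
    have "sinks_det w v0 qs = 0"
      by (rule sinks_det_zero_row[OF i(1)]) (use i z' in auto)
    then show ?thesis by (simp add: S)
  qed
qed

text \<open>The Lindstroem--Gessel--Viennot identity. Deleting the last vertex of a path that ends in the
  lowest row satisfies the same linear recursion on both sides, so no sign-reversing involution is
  needed.\<close>

lemma systems_to_eq_det:
  assumes "staircase qs" "w = (\<lambda>a b. W (u0 + a, b))"
  shows "finite (systems_to u0 v0 qs) \<and>
    (\<Sum>ps\<in>systems_to u0 v0 qs. system_weight W ps) = sinks_det w v0 qs"
  using assms(1)
\<comment> \<open>Moving a sink up or left lowers the sum of all coordinates by one.\<close>
proof (induction "sum_list (map (\<lambda>q. fst q + snd q) qs)" arbitrary: qs rule: less_induct)
  case less
  note st = less.prems
  show ?case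
  proof (cases "\<forall>q\<in>set qs. fst q = 0")
    case True
    then show ?thesis by (rule systems_to_eq_det_base[OF st])
  next
    case False
    let ?k = "length qs"
    define m where "m = fst (qs ! 0)"
    have le_m: "fst (qs ! i) \<le> m" if "i < ?k" for i
      using st that by (cases "i = 0") (auto simp: staircase_def m_def)
    \<comment> \<open>The last sink in the lowest row is the one whose final vertex is
      removed.\<close>
    define n where "n = Max {i. i < ?k \<and> fst (qs ! i) = m}"
    have k0: "0 < ?k" using False by auto
    have "n \<in> {i. i < ?k \<and> fst (qs ! i) = m}"
      unfolding n_def by (rule Max_in) (use k0 m_def in auto)
    then have n: "n < ?k" "fst (qs ! n) = m" by auto
    have above: "fst (qs ! i) < m" if "i < ?k" "n < i" for i
    proof (rule ccontr)
      assume "\<not> fst (qs ! i) < m"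
      then have "i \<in> {i. i < ?k \<and> fst (qs ! i) = m}" using le_m[OF that(1)] that(1) by simp
      then have "i \<le> n" unfolding n_def by (intro Max_ge) auto
      then show False using that(2) by simp
    qed
    have below: "fst (qs ! i) = m" if "i < n" for i
      using st n that le_m[of i] by (fastforce simp: staircase_def)
    have "m \<noteq> 0" using False le_m by (fastforce simp: in_set_conv_nth)
    then obtain a where a: "m = Suc a" using not0_implies_Suc by blast
    show ?thesis
    proof (cases "snd (qs ! n)")
      \<comment> \<open>All sources are in positive columns, so no path reaches column 0, and the
        row of this sink is zero.\<close>
      case 0
      have "systems_to u0 v0 qs = {}"
      proof (rule ccontr)
        assume "systems_to u0 v0 qs \<noteq> {}"
        then obtain ps where "ps \<in> systems_to u0 v0 qs" by blast
        then have "path_to u0 (Suc v0 + n) (qs ! n) (ps ! n)"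
          using n(1) by (simp add: systems_to_def)
        then have lp: "lattice_path (ps ! n) (Suc u0, Suc v0 + n) (u0 + Suc a, 0)"
          using n(2) a 0 by (simp add: path_to_def)
        then have "(u0 + Suc a, 0) \<in> set (ps ! n)"
          by (metis lattice_path_def last_in_set)
        then show False
          using lattice_path_bounds[OF lp] by (fastforce simp: less_eq_prod_def)
      qed
      moreover have "sinks_det w v0 qs = 0"
        by (rule sinks_det_zero_row[OF n(1)]) (simp add: 0 n(2) a)
      ultimately show ?thesis by simp
    next
      case (Suc b)
      define us where "us = take n qs"
      define ws where "ws = drop (Suc n) qs"
      have qn: "qs ! n = (Suc a, Suc b)" using n(2) a Suc by (cases "qs ! n") simp
      have qs: "qs = us @ (Suc a, Suc b) # ws"
        using id_take_nth_drop[OF n(1)] qn by (simp add: us_def ws_def)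
      have lu: "length us = n" using n(1) by (simp add: us_def)
      let ?up = "us @ (a, Suc b) # ws"
      let ?lt = "us @ (Suc a, b) # ws"
      have up_nth: "?up ! i = (if i = n then (a, Suc b) else qs ! i)" for i
        by (auto simp: qs lu[symmetric] nth_append nth_Cons split: nat.split)
      have lt_nth: "?lt ! i = (if i = n then (Suc a, b) else qs ! i)" for i
        by (auto simp: qs lu[symmetric] nth_append nth_Cons split: nat.split)
      have len: "length ?up = ?k" "length ?lt = ?k" by (simp_all add: qs)
      have wsa: "\<forall>q\<in>set ws. fst q \<le> a"
      proof
        fix q assume "q \<in> set ws"
        then obtain i where "i < length ws" "q = qs ! (Suc n + i)"
          using n(1) by (auto simp: in_set_conv_nth ws_def)
        then show "fst q \<le> a"
          using above[of "Suc n + i"] a by (simp add: ws_def less_Suc_eq_le)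
      qed
      have ord: "fst (qs ! j) \<le> fst (qs ! i) \<and> snd (qs ! i) < snd (qs ! j)" if "j < ?k" "i < j" for i j
        using st that by (simp add: staircase_def)
      have "staircase ?up"
        unfolding staircase_def len up_nth
      proof (intro allI impI)
        fix j i assume ji: "j < ?k" "i < j"
        show "fst (if j = n then (a, Suc b) else qs ! j) \<le> fst (if i = n then (a, Suc b) else qs ! i) \<and>
              snd (if i = n then (a, Suc b) else qs ! i) < snd (if j = n then (a, Suc b) else qs ! j)"
          using ord[OF ji] above[of j] below[of i] a qn ji by auto
      qed
      then have IHu: "finite (systems_to u0 v0 ?up)"
          "(\<Sum>ps\<in>systems_to u0 v0 ?up. system_weight W ps) = sinks_det w v0 ?up"
        using less.hyps[of ?up] by (simp_all add: qs)
      have IHl: "finite (systems_to u0 v0 ?lt) \<and>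
          (\<Sum>ps\<in>systems_to u0 v0 ?lt. system_weight W ps) = sinks_det w v0 ?lt"
      \<comment> \<open>Moving left may run into the preceding sink. The staircase is then lost, but
        both sides vanish: two paths would share their end, and two rows coincide.\<close>
      proof (cases "0 < n \<and> snd (qs ! (n - 1)) = b")
        case True
        then have dup: "?lt ! (n - 1) = (Suc a, b)" "?lt ! n = (Suc a, b)"
          using below[of "n - 1"] a by (simp_all add: lt_nth prod_eq_iff)
        have "systems_to u0 v0 ?lt = {}"
        proof (rule ccontr)
          assume "systems_to u0 v0 ?lt \<noteq> {}"
          then obtain ps where ps: "ps \<in> systems_to u0 v0 ?lt" by blast
          have "path_to u0 (Suc v0 + i) (?lt ! i) (ps ! i)" if "i < ?k" for i
            using ps that unfolding systems_to_def len by blast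
          from path_to_last[OF this[of n]] path_to_last[OF this[of "n - 1"]]
          have "(u0 + Suc a, b) \<in> set (ps ! n) \<inter> set (ps ! (n - 1))"
            using dup n(1) True by (metis IntI fst_conv last_in_set less_imp_diff_less snd_conv zero_less_Suc)
          moreover have "set (ps ! n) \<inter> set (ps ! (n - 1)) = {}"
          proof -
            have "n - 1 < ?k" "n \<noteq> n - 1" using n(1) True by auto
            then show ?thesis using ps n(1) unfolding systems_to_def len by blast
          qed
          ultimately show False by blast
        qed
        moreover have "sinks_det w v0 ?lt = 0"
          by (rule sinks_det_same[of n _ "n - 1"]) (use dup n(1) True len in auto)
        ultimately show ?thesis by simp
      next
        case False
        have lt: "snd (qs ! i) < b" if "i < n" for i
        proof -
          have "snd (qs ! (n - 1)) < Suc b" using ord[OF n(1), of "n - 1"] that qn by simp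
          then have "snd (qs ! (n - 1)) < b" using False that by simp
          moreover have "snd (qs ! i) \<le> snd (qs ! (n - 1))"
          proof (cases "i = n - 1")
            case False
            then have "n - 1 < ?k" "i < n - 1" using that n(1) by linarith+
            then show ?thesis using ord by (simp add: less_imp_le)
          qed simp
          ultimately show ?thesis by simp
        qed
        have "staircase ?lt"
          unfolding staircase_def len lt_nth
        proof (intro allI impI)
          fix j i assume ji: "j < ?k" "i < j"
          show "fst (if j = n then (Suc a, b) else qs ! j) \<le> fst (if i = n then (Suc a, b) else qs ! i) \<and>
                snd (if i = n then (Suc a, b) else qs ! i) < snd (if j = n then (Suc a, b) else qs ! j)"
            using ord[OF ji] lt[of i] a qn ji by auto
        qed
        then show ?thesis
          using less.hyps[of ?lt] by (simp add: qs)
      qed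
      note step = systems_to_step[OF st[unfolded qs] wsa, where ?u0.0 = u0 and ?v0.0 = v0, folded qs]
      define f where "f = (\<lambda>ps :: (nat \<times> nat) list list.
        ps[length us := ps ! length us @ [(u0 + Suc a, Suc b)]])"
      have "(\<Sum>ps\<in>systems_to u0 v0 qs. system_weight W ps) =
            (\<Sum>ps\<in>systems_to u0 v0 ?up \<union> systems_to u0 v0 ?lt. system_weight W (f ps))"
        unfolding step(1) f_def using step(2) by (subst sum.reindex) (simp_all add: o_def)
      also have "\<dots> = (\<Sum>ps\<in>systems_to u0 v0 ?up \<union> systems_to u0 v0 ?lt.
            W (u0 + Suc a, Suc b) * system_weight W ps)"
        by (rule sum.cong[OF refl]) (unfold f_def, rule step(4))
      also have "\<dots> = W (u0 + Suc a, Suc b) * (sinks_det w v0 ?up + sinks_det w v0 ?lt)"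
        using IHu IHl step(3) by (simp add: sum.union_disjoint sum_distrib_left[symmetric] distrib_left)
      also have "\<dots> = sinks_det w v0 qs"
        by (simp only: qs sinks_det_step assms(2))
      finally show ?thesis
        using IHu(1) IHl step(1) by simp
    qed
  qed
qed

section \<open>Recursions for path determinants\<close>

definition row_det :: "(nat \<Rightarrow> nat \<Rightarrow> real) \<Rightarrow> nat \<Rightarrow> nat \<Rightarrow> nat \<Rightarrow> nat \<Rightarrow> real" where
  "row_det w v0 k a j = sinks_det w v0 (map (\<lambda>i. (a, j + i)) [0..<k])"

lemma row_det_0 [simp]: "row_det w v0 0 a j = 1"
  by (simp add: row_det_def sinks_det_def)

lemma sinks_det_Nil [simp]: "sinks_det w v0 [] = 1"
  by (simp add: sinks_det_def)

lemma path_sum_eq_0: "b < c \<Longrightarrow> path_sum w c a b = 0"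
  by (induction w c a b rule: path_sum.induct) auto

lemma path_sum_straight: "path_sum w (Suc c) a (Suc c) = (\<Prod>t = 1..a. w t (Suc c))"
  by (induction a) (simp_all add: path_sum_eq_0 mult.commute)

text \<open>Expand the sinks of the row from right to left, except the first one. The summand that
  moves a sink to the left repeats the preceding sink and vanishes, so only the upward move
  survives.\<close>

lemma sinks_det_push_up:
  "sinks_det w v0 (us @ map (\<lambda>i. (Suc a, j + i)) [0..<Suc m] @ ws) =
     (\<Prod>i=1..m. w (Suc a) (j + i)) *
     sinks_det w v0 (us @ (Suc a, j) # map (\<lambda>i. (a, Suc j + i)) [0..<m] @ ws)"
proof (induction m arbitrary: ws)
  case (Suc m)
  let ?row = "map (\<lambda>i. (Suc a, j + i)) [0..<Suc m]"
  have "sinks_det w v0 ((us @ ?row) @ (Suc a, j + m) # ws) = 0"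
    by (rule sinks_det_same[of "length us + m" _ "length us + Suc m"])
       (simp_all add: nth_append)
  then have "sinks_det w v0 (us @ map (\<lambda>i. (Suc a, j + i)) [0..<Suc (Suc m)] @ ws) =
      w (Suc a) (j + Suc m) * sinks_det w v0 (us @ ?row @ (a, j + Suc m) # ws)"
    using sinks_det_step[of w v0 "us @ ?row" a "j + m" ws] by simp
  then show ?case
    by (simp only: Suc.IH) (simp add: mult.commute)
qed simp

lemma row_det_push_up:
  "row_det w v0 (Suc m) (Suc a) j =
     (\<Prod>i=1..m. w (Suc a) (j + i)) * sinks_det w v0 ((Suc a, j) # map (\<lambda>i. (a, Suc j + i)) [0..<m])"
  using sinks_det_push_up[of w v0 "[]" a j m "[]"] by (simp add: row_det_def)

lemma upt_map_Suc_shift: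
  "map f [0..<Suc k] = f 0 # map (\<lambda>i. f (Suc i)) [0..<k]"
  by (simp add: map_upt_Suc del: upt_Suc)

text \<open>Pushing up all but the first sink of row \<open>Suc a\<close> makes the six minors share
  the rows \<open>S\<close>. What remains is a Pluecker relation for \<open>X\<close>,
  \<open>Y\<close>, \<open>Z\<close> and a unit row \<open>e\<close> that pads the smaller
  minors.\<close>

lemma row_det_recursion:
  "row_det w v0 (Suc m) (Suc a) (Suc d) * row_det w v0 m a (Suc d) =
     w (Suc a) (Suc d + m) *
       (row_det w v0 (Suc m) a (Suc d) * row_det w v0 m (Suc a) (Suc d) +
        row_det w v0 (Suc m) (Suc a) d * row_det w v0 m a (Suc (Suc d)))"
proof (cases m)
  case 0
  then show ?thesis
    using sinks_det_step[of w v0 "[]" a d "[]"] by (simp add: row_det_def)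
next
  case (Suc l)
  define V where "V = (\<lambda>q i. path_sum w (Suc v0 + i) (fst q) (snd q))"
  define S where "S = map (\<lambda>i. V (a, Suc (Suc d) + i)) [0..<l]"
  define X where "X = V (Suc a, Suc d)"
  define Y where "Y = V (a, Suc d)"
  define Z where "Z = V (a, Suc (Suc d) + l)"
  define e where "e = (\<lambda>i :: nat. if i = Suc l then 1 else 0 :: real)"
  define B where "B = (\<lambda>p q. rows_det (p # S @ [q]))"
  define P where "P = (\<Prod>i=1..l. w (Suc a) (Suc d + i))"
  define \<sigma> where "\<sigma> = (- 1 :: real) ^ l"
  have sd: "sinks_det w v0 qs = rows_det (map V qs)" for qs
    by (simp add: sinks_det_def V_def)
  have lS: "length S = l" by (simp add: S_def)
  have 1: "row_det w v0 (Suc m) (Suc a) (Suc d) = P * w (Suc a) (Suc d + m) * B X Z"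
    by (simp add: row_det_push_up sd Suc B_def X_def S_def Z_def P_def o_def)
  have 2: "row_det w v0 m a (Suc d) = B Y e"
    using rows_det_last_unit[of "Y # S" e] lS
    by (simp add: row_det_def sd Suc upt_map_Suc_shift B_def Y_def S_def e_def o_def del: upt_Suc)
  have 3: "row_det w v0 (Suc m) a (Suc d) = B Y Z"
    unfolding row_det_def sd Suc upt_map_Suc_shift[of _ "Suc l"] B_def Y_def S_def Z_def
    by (simp add: o_def)
  have 4: "row_det w v0 m (Suc a) (Suc d) = P * B X e"
    using rows_det_last_unit[of "X # S" e] lS
    by (simp add: row_det_push_up sd Suc B_def X_def S_def P_def e_def o_def)
  \<comment> \<open>Here the window starts one column further left. As \<open>X\<close> is a
    multiple of \<open>Y + ?U\<close> and \<open>Y\<close> is among the rows, \<open>?U\<close> can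
    be replaced by \<open>X\<close>; the factor this costs is the surplus factor of the
    product.\<close>
  have 5: "row_det w v0 (Suc m) (Suc a) d = P * \<sigma> * B X Y"
  proof -
    let ?U = "V (Suc a, d)"
    have "row_det w v0 (Suc m) (Suc a) d = (\<Prod>i=1..m. w (Suc a) (d + i)) * rows_det (?U # Y # S)"
      unfolding row_det_push_up sd unfolding Suc upt_map_Suc_shift
      by (simp add: Y_def S_def o_def del: upt_Suc)
    also have "(\<Prod>i=1..m. w (Suc a) (d + i)) = w (Suc a) (Suc d) * P"
      unfolding P_def Suc by (subst prod.atLeast_Suc_atMost) (simp_all add: prod.shift_bounds_cl_Suc_ivl del: prod.cl_ivl_Suc)
    also have "w (Suc a) (Suc d) * P * rows_det (?U # Y # S) = P * rows_det (X # Y # S)"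
    proof -
      have "rows_det (X # Y # S) = w (Suc a) (Suc d) * (rows_det (Y # Y # S) + rows_det (?U # Y # S))"
        using rows_det_add_scale[of X "w (Suc a) (Suc d)" Y ?U "[]" "Y # S"]
        by (simp add: X_def Y_def V_def)
      moreover have "rows_det (Y # Y # S) = 0"
        by (rule rows_det_same[of 0 _ 1]) auto
      ultimately show ?thesis by simp
    qed
    also have "rows_det (X # Y # S) = \<sigma> * B X Y"
      using rows_det_move[of "[X]" Y S "[]"] lS by (simp add: B_def \<sigma>_def)
    finally show ?thesis by (simp only: mult.assoc)
  qed
  have 6: "row_det w v0 m a (Suc (Suc d)) = \<sigma> * B Z e"
  proof -
    have "row_det w v0 m a (Suc (Suc d)) = rows_det ((S @ [Z]) @ [e])"
      using rows_det_last_unit[of "S @ [Z]" e] lS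
      by (simp add: row_det_def sd Suc S_def Z_def e_def o_def)
    then show ?thesis
      using rows_det_move[of "[]" Z S "[e]"] lS
      by (simp add: B_def \<sigma>_def flip: power_add)
  qed
  have "\<sigma> * \<sigma> = 1" by (simp add: \<sigma>_def flip: power_add)
  then have \<sigma>: "P * \<sigma> * x * (\<sigma> * y) = P * (x * y)" for x y
    by (metis mult.assoc mult.left_commute mult_1)
  have "B X Z * B Y e = B X e * B Y Z + B X Y * B Z e"
    using rows_det_plucker[of X S Y Z e] by (simp add: B_def)
  then have "P * w (Suc a) (Suc d + m) * (B X Z * B Y e) =
      P * w (Suc a) (Suc d + m) * (B X e * B Y Z + B X Y * B Z e)" by (rule arg_cong)
  then show ?thesis
    unfolding 1 2 3 4 5 6 \<sigma> by (simp add: algebra_simps)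
qed

text \<open>The unit row \<open>e\<close> deletes the column of the first source, and
  \<open>e'\<close> pads a minor by a last column. With both, all six minors are brackets over the
  common rows \<open>S\<close>.\<close>

lemma row_det_dodgson:
  "row_det w v0 (Suc l) a j * row_det w (Suc v0) (Suc l) a (Suc j) =
     row_det w (Suc v0) (Suc l) a j * row_det w v0 (Suc l) a (Suc j) +
     row_det w v0 (Suc (Suc l)) a j * row_det w (Suc v0) l a (Suc j)"
proof -
  define V where "V = (\<lambda>q i. path_sum w (Suc v0 + i) (fst q) (snd q))"
  define S where "S = map (\<lambda>i. V (a, Suc j + i)) [0..<l]"
  define X where "X = V (a, j)"
  define Y where "Y = V (a, Suc j + l)"
  define e where "e = (\<lambda>i :: nat. if i = 0 then 1 else 0 :: real)"
  define e' where "e' = (\<lambda>i :: nat. if i = Suc l then 1 else 0 :: real)"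
  define B where "B = (\<lambda>p q. rows_det (p # S @ [q]))"
  define \<sigma> where "\<sigma> = (- 1 :: real) ^ l"
  have sd: "sinks_det w v0 qs = rows_det (map V qs)" for qs
    by (simp add: sinks_det_def V_def)
  have sd': "sinks_det w (Suc v0) qs = rows_det (e # map V qs)" for qs
    using rows_det_first_unit[of e "map V qs"] by (simp add: sinks_det_def V_def e_def o_def)
  have lS: "length S = l" by (simp add: S_def)
  have 1: "row_det w v0 (Suc l) a j = B X e'"
    using rows_det_last_unit[of "X # S" e'] lS
    by (simp add: row_det_def sd upt_map_Suc_shift B_def X_def S_def e'_def o_def del: upt_Suc)
  have 2: "row_det w (Suc v0) (Suc l) a (Suc j) = B e Y"
    by (simp add: row_det_def sd' B_def S_def Y_def o_def)
  have 3: "row_det w (Suc v0) (Suc l) a j = \<sigma> * B e X"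
    using rows_det_move[of "[e]" X S "[]"] lS
    by (simp add: row_det_def sd' upt_map_Suc_shift B_def X_def S_def \<sigma>_def o_def del: upt_Suc)
  have 4: "row_det w v0 (Suc l) a (Suc j) = \<sigma> * B Y e'"
  proof -
    have "row_det w v0 (Suc l) a (Suc j) = rows_det ((S @ [Y]) @ [e'])"
      using rows_det_last_unit[of "S @ [Y]" e'] lS
      by (simp add: row_det_def sd S_def Y_def e'_def o_def)
    then show ?thesis
      using rows_det_move[of "[]" Y S "[e']"] lS
      by (simp add: B_def \<sigma>_def flip: power_add)
  qed
  have 5: "row_det w v0 (Suc (Suc l)) a j = B X Y"
    unfolding row_det_def sd upt_map_Suc_shift[of _ "Suc l"] B_def X_def S_def Y_def
    by (simp add: o_def)
  have 6: "row_det w (Suc v0) l a (Suc j) = B e e'"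
    using rows_det_last_unit[of "e # S" e'] lS
    by (simp add: row_det_def sd' B_def S_def e'_def o_def)
  have "\<sigma> * \<sigma> = 1" by (simp add: \<sigma>_def flip: power_add)
  then have \<sigma>: "\<sigma> * x * (\<sigma> * y) = x * y" for x y
    by (metis mult.assoc mult.left_commute mult_1)
  have "B e Y * B X e' = B e X * B Y e' + B e e' * B X Y"
    using rows_det_plucker[of e S X Y e'] by (simp add: B_def)
  then show ?thesis
    unfolding 1 2 3 4 5 6 \<sigma> by (simp add: mult.commute)
qed

section \<open>Vanishing, product formulas and positivity of path determinants\<close>

lemma row_det_eq_0_left:
  assumes "0 < k" "j \<le> v0"
  shows "row_det w v0 k a j = 0"
  unfolding row_det_def by (rule sinks_det_zero_row[of 0]) (use assms in \<open>auto simp: path_sum_eq_0\<close>)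

text \<open>Push the row up repeatedly; every push leaves one sink behind in \<open>us\<close>. Some
  sink still remains when row 0 is reached, and it lies to the right of all sources.\<close>

lemma sinks_det_few_rows:
  assumes "a < k" "Suc (v0 + length us) < j"
  shows "sinks_det w v0 (us @ map (\<lambda>i. (a, j + i)) [0..<k]) = 0"
  using assms
proof (induction a arbitrary: us j k)
  case 0
  then show ?case
    by (intro sinks_det_zero_row[of "length us + (k - 1)"]) (auto simp: nth_append)
next
  case (Suc a)
  then obtain m where m: "k = Suc m" by (cases k) auto
  have "sinks_det w v0 ((us @ [(Suc a, j)]) @ map (\<lambda>i. (a, Suc j + i)) [0..<m]) = 0"
    using Suc.prems by (intro Suc.IH) (auto simp: m)
  then show ?case
    using sinks_det_push_up[of w v0 us a j m "[]"] by (simp add: m)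
qed

lemma row_det_eq_0_few_rows:
  assumes "a < k" "Suc v0 < j"
  shows "row_det w v0 k a j = 0"
  unfolding row_det_def using sinks_det_few_rows[of a k v0 "[]" j w] assms by simp

text \<open>Every sink is in the column of its source, so the matrix is triangular and its diagonal
  entries come from vertical paths.\<close>

lemma row_det_full_width:
  "row_det w v0 k a (Suc v0) = (\<Prod>i=1..k. \<Prod>t=1..a. w t (v0 + i))"
proof -
  have "row_det w v0 k a (Suc v0) = (\<Prod>i<k. \<Prod>t=1..a. w t (Suc (v0 + i)))"
    unfolding row_det_def sinks_det_def
    by (subst rows_det_lower_triangular) (auto simp: path_sum_eq_0 path_sum_straight)
  also have "\<dots> = (\<Prod>i=1..k. \<Prod>t=1..a. w t (v0 + i))"
    by (rule prod.reindex_bij_witness[of _ "\<lambda>i. i - 1" Suc]) auto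
  finally show ?thesis .
qed

text \<open>As many paths as rows must cover the whole rectangle. In the recursion the term with
  \<open>Suc m\<close> sinks in row \<open>m\<close> vanishes, the other factors are known by
  induction, and positivity allows cancellation.\<close>

lemma row_det_full_height:
  assumes pos: "\<And>t i. 0 < w t i"
  shows "row_det w v0 m m (Suc v0 + e) = (\<Prod>i=1..m + e. \<Prod>t=1..m. w t (v0 + i))"
proof (induction m arbitrary: e)
  case (Suc m)
  show ?case
  proof (induction e)
    case 0
    show ?case using row_det_full_width[of w v0 "Suc m" "Suc m"] by simp
  next
    case IH: (Suc e)
    define R where "R = (\<lambda>a i. \<Prod>t=1..a. w t (v0 + i))"
    define F where "F = (\<lambda>a b. \<Prod>i=1..b. R a i)"
    define n where "n = m + Suc e"
    have F: "0 < F a b" for a b unfolding F_def R_def by (intro prod_pos ballI pos)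
    have FS: "F a (Suc b) = F a b * R a (Suc b)" for a b by (simp add: F_def)
    have RS: "R (Suc m) i = R m i * w (Suc m) (v0 + i)" for i by (simp add: R_def)
    have h: "row_det w v0 m m (Suc v0 + e') = F m (m + e')" for e'
      by (simp only: Suc.IH F_def R_def)
    have h': "row_det w v0 (Suc m) (Suc m) (Suc v0 + e) = F (Suc m) n"
      using IH by (simp add: F_def R_def n_def)
    have "row_det w v0 (Suc m) (Suc m) (Suc (Suc v0 + e)) * row_det w v0 m m (Suc v0 + Suc e) =
      w (Suc m) (v0 + Suc n) *
        (row_det w v0 (Suc m) (Suc m) (Suc v0 + e) * row_det w v0 m m (Suc v0 + Suc (Suc e)))"
      using row_det_recursion[of w v0 m m "Suc v0 + e"]
      by (simp add: row_det_eq_0_few_rows n_def ac_simps)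
    then have "row_det w v0 (Suc m) (Suc m) (Suc (Suc v0 + e)) * F m n =
      w (Suc m) (v0 + Suc n) * (F (Suc m) n * F m (Suc n))"
      unfolding h h' by (simp add: n_def)
    also have "\<dots> = F (Suc m) (Suc n) * F m n"
      by (simp add: FS RS mult_ac)
    finally have "row_det w v0 (Suc m) (Suc m) (Suc (Suc v0 + e)) = F (Suc m) (Suc n)"
      using F[of m n] by simp
    then show ?case by (simp add: F_def R_def n_def)
  qed
qed simp

text \<open>The recursion writes the minor times a positive minor as a sum of nonnegative terms, one
  of them positive.\<close>

lemma row_det_pos:
  assumes pos: "\<And>t i. 0 < w t i"
  shows "k \<le> a \<Longrightarrow> 0 < row_det w v0 k a (Suc v0 + e)"
proof (induction k arbitrary: a e)
  case (Suc m)
  note IHk = Suc.IH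
  show ?case using Suc.prems
  proof (induction a arbitrary: e)
    case (Suc a)
    note IHa = Suc.IH and ma = Suc.prems
    show ?case
    proof (induction e)
      case 0
      show ?case using row_det_full_width[of w v0 "Suc m" "Suc a"] pos
        by (auto intro!: prod_pos mult_pos_pos simp del: prod.cl_ivl_Suc)
    next
      case (Suc e)
      \<comment> \<open>This minor vanishes when \<open>a = m\<close>, hence only the weak
        inequality.\<close>
      have "0 \<le> row_det w v0 (Suc m) a (Suc (Suc v0 + e))"
        using IHa[of "Suc e"] row_det_eq_0_few_rows[of a "Suc m" v0 "Suc (Suc v0 + e)" w]
        by (cases "Suc m \<le> a") (auto intro: less_imp_le)
      moreover have "0 < row_det w v0 m (Suc a) (Suc (Suc v0 + e))"
        using IHk[of "Suc a" "Suc e"] ma by simp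
      moreover have "0 < row_det w v0 (Suc m) (Suc a) (Suc v0 + e)" by (rule Suc.IH)
      moreover have "0 < row_det w v0 m a (Suc (Suc (Suc v0 + e)))"
        using IHk[of a "Suc (Suc e)"] ma by simp
      ultimately have "0 < row_det w v0 (Suc m) (Suc a) (Suc (Suc v0 + e)) * row_det w v0 m a (Suc (Suc v0 + e))"
        unfolding row_det_recursion
        by (intro mult_pos_pos[OF pos] add_nonneg_pos mult_nonneg_nonneg mult_pos_pos) simp_all
      moreover have "0 < row_det w v0 m a (Suc (Suc v0 + e))"
        using IHk[of a "Suc e"] ma by simp
      ultimately show ?case by (simp add: zero_less_mult_iff)
    qed
  qed simp
qed simp

section \<open>Tropicalization\<close>

text \<open>On this logarithmic scale products become sums and sums become maxima. Positivity is
  included so that \<open>ln\<close> is a genuine logarithm.\<close>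

definition growth :: "(real \<Rightarrow> real) \<Rightarrow> real \<Rightarrow> bool" where
  "growth F L \<longleftrightarrow> (\<forall>\<theta>. 0 < F \<theta>) \<and> ((\<lambda>\<theta>. ln (F \<theta>) / \<theta>) \<longlongrightarrow> L) at_top"

lemma growth_exp: "growth (\<lambda>\<theta>. exp (\<theta> * c)) c"
proof -
  have "((\<lambda>\<theta>. ln (exp (\<theta> * c)) / \<theta>) \<longlongrightarrow> c) at_top"
    by (rule tendsto_eventually, rule eventually_mono[OF eventually_gt_at_top[of 0]]) simp
  then show ?thesis by (simp add: growth_def)
qed

lemma growth_mult:
  assumes "growth F a" "growth G b"
  shows "growth (\<lambda>\<theta>. F \<theta> * G \<theta>) (a + b)"
proof -
  have "ln (F \<theta> * G \<theta>) / \<theta> = ln (F \<theta>) / \<theta> + ln (G \<theta>) / \<theta>" for \<theta>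
  proof -
    have "0 < F \<theta>" "0 < G \<theta>" using assms by (simp_all add: growth_def)
    then show ?thesis by (simp add: ln_mult_pos add_divide_distrib)
  qed
  then show ?thesis
    using assms by (auto simp: growth_def intro: tendsto_add)
qed

lemma growth_add:
  assumes "growth F a" "growth G b"
  shows "growth (\<lambda>\<theta>. F \<theta> + G \<theta>) (max a b)"
proof -
  have pos: "0 < F \<theta>" "0 < G \<theta>" for \<theta> using assms by (auto simp: growth_def)
  let ?M = "\<lambda>\<theta>. max (ln (F \<theta>) / \<theta>) (ln (G \<theta>) / \<theta>)"
  have M: "(?M \<longlongrightarrow> max a b) at_top"
    using assms unfolding growth_def by (intro tendsto_max) auto
  have "((\<lambda>\<theta> :: real. ln 2 / \<theta>) \<longlongrightarrow> 0) at_top"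
    by (rule tendsto_divide_0[OF tendsto_const])
       (rule filterlim_mono[OF filterlim_ident at_top_le_at_infinity order_refl])
  from tendsto_add[OF this M]
  have M2: "((\<lambda>\<theta>. ln 2 / \<theta> + ?M \<theta>) \<longlongrightarrow> max a b) at_top" by simp
  have "((\<lambda>\<theta>. ln (F \<theta> + G \<theta>) / \<theta>) \<longlongrightarrow> max a b) at_top"
  \<comment> \<open>The sum lies between the larger summand and twice that summand, and
    \<open>ln 2 / \<theta>\<close> tends to 0.\<close>
  proof (rule tendsto_sandwich[OF _ _ M M2])
    show "\<forall>\<^sub>F \<theta> in at_top. ?M \<theta> \<le> ln (F \<theta> + G \<theta>) / \<theta>"
      using eventually_gt_at_top[of 0]
    proof eventually_elim
      case (elim \<theta>)
      have "ln (F \<theta>) \<le> ln (F \<theta> + G \<theta>)" "ln (G \<theta>) \<le> ln (F \<theta> + G \<theta>)"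
        using pos[of \<theta>] by simp_all
      then show ?case using elim by (simp add: divide_right_mono)
    qed
    show "\<forall>\<^sub>F \<theta> in at_top. ln (F \<theta> + G \<theta>) / \<theta> \<le> ln 2 / \<theta> + ?M \<theta>"
      using eventually_gt_at_top[of 0]
    proof eventually_elim
      case (elim \<theta>)
      have "ln (F \<theta> + G \<theta>) \<le> ln (2 * max (F \<theta>) (G \<theta>))"
        using pos[of \<theta>] by (subst ln_le_cancel_iff) auto
      also have "\<dots> = ln 2 + ln (max (F \<theta>) (G \<theta>))"
        using pos[of \<theta>] by (intro ln_mult_pos) (auto simp: less_max_iff_disj)
      finally have "ln (F \<theta> + G \<theta>) / \<theta> \<le> ln 2 / \<theta> + ln (max (F \<theta>) (G \<theta>)) / \<theta>"
        using elim by (simp add: divide_right_mono flip: add_divide_distrib)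
      moreover have "ln (max (F \<theta>) (G \<theta>)) / \<theta> \<le> ?M \<theta>"
        by (simp add: max_def)
      ultimately show ?case by linarith
    qed
  qed
  then show ?thesis using pos by (simp add: growth_def add_pos_pos)
qed

lemma growth_unique: "growth F a \<Longrightarrow> growth F b \<Longrightarrow> a = b"
  unfolding growth_def by (metis tendsto_unique trivial_limit_at_top_linorder)

lemma growth_sum:
  assumes "finite S" "S \<noteq> {}"
  shows "growth (\<lambda>\<theta>. \<Sum>s\<in>S. exp (\<theta> * f s)) (Max (f ` S))"
  using assms
proof (induction S rule: finite_ne_induct)
  case (singleton s)
  then show ?case by (simp add: growth_exp)
next
  case (insert s S)
  then show ?case using growth_add[OF growth_exp[of "f s"] insert.IH] by simp
qed

section \<open>Path maxima as growth rates of path determinants\<close>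

definition exp_weight :: "nat \<Rightarrow> (nat \<times> nat \<Rightarrow> real) \<Rightarrow> real \<Rightarrow> nat \<Rightarrow> nat \<Rightarrow> real" where
  "exp_weight u0 x \<theta> a b = exp (\<theta> * x (u0 + a, b))"

lemma path_systems_eq_systems_to:
  assumes "0 < a"
  shows "path_systems (Suc u0) (Suc v0) (u0 + a) v2 k =
         systems_to u0 v0 (map (\<lambda>i. (a, v2 + 1 - k + i)) [0..<k])"
  using assms by (auto simp: path_systems_def systems_to_def path_to_def)

text \<open>\<open>H\<close> in terms of the size of the rectangle and the offsets
  \<open>u0\<close>, \<open>v0\<close> of its corner, as suits recursions in the size.\<close>

definition path_max ::
  "(nat \<times> nat \<Rightarrow> real) \<Rightarrow> nat \<Rightarrow> nat \<Rightarrow> nat \<Rightarrow> nat \<Rightarrow> nat \<Rightarrow> real" where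
  "path_max x u0 v0 m a b = H (Suc u0) (Suc v0) (u0 + a) (v0 + b) x m"

lemma path_max_0 [simp]: "path_max x u0 v0 0 a b = 0"
  by (simp add: path_max_def H_def path_systems_def path_weight_def)

lemma growth_path_max:
  assumes "m \<le> a" "m \<le> b"
  shows "growth (\<lambda>\<theta>. row_det (exp_weight u0 x \<theta>) v0 m a (Suc v0 + (b - m))) (path_max x u0 v0 m a b)"
proof (cases "m = 0")
  case True
  then show ?thesis using growth_exp[of 0] by simp
next
  case False
  let ?S = "path_systems (Suc u0) (Suc v0) (u0 + a) (v0 + b) m"
  let ?qs = "map (\<lambda>i. (a, Suc v0 + (b - m) + i)) [0..<m]"
  have a: "0 < a" using False assms by simp
  have v: "v0 + b + 1 - m = Suc v0 + (b - m)" using assms by simp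
  have S: "?S = systems_to u0 v0 ?qs"
    using path_systems_eq_systems_to[OF a, of u0 v0 "v0 + b" m] by (simp only: v)
  have st: "staircase ?qs" by (simp add: staircase_def)
  have LGV: "finite ?S \<and> (\<Sum>ps\<in>?S. system_weight (\<lambda>p. exp (\<theta> * x p)) ps) =
      row_det (exp_weight u0 x \<theta>) v0 m a (Suc v0 + (b - m))" for \<theta>
    unfolding S row_det_def by (rule systems_to_eq_det[OF st]) (simp add: exp_weight_def fun_eq_iff)
  have eq: "row_det (exp_weight u0 x \<theta>) v0 m a (Suc v0 + (b - m)) =
      (\<Sum>ps\<in>?S. exp (\<theta> * path_weight x ps))" for \<theta>
  proof -
    have "system_weight (\<lambda>p. exp (\<theta> * x p)) ps = exp (\<theta> * path_weight x ps)" for ps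
      by (simp add: system_weight_def path_weight_def exp_sum sum_distrib_left)
    then show ?thesis using LGV[of \<theta>] by simp
  qed
  \<comment> \<open>At \<open>\<theta> = 0\<close> the determinant counts the systems; being
    positive, it shows that there is one.\<close>
  have "0 < row_det (exp_weight u0 x 0) v0 m a (Suc v0 + (b - m))"
    by (rule row_det_pos) (use assms in \<open>simp_all add: exp_weight_def\<close>)
  then have "?S \<noteq> {}" using eq[of 0] by auto
  moreover have "path_max x u0 v0 m a b = Max (path_weight x ` ?S)"
    using assms False by (simp add: path_max_def H_def)
  ultimately show ?thesis
    unfolding eq using LGV[of 0] growth_sum[of ?S "path_weight x"] by simp
qed

text \<open>The case distinctions below account for the systems that do not exist: the corresponding
  determinants vanish, whereas \<open>H\<close> is extended by a constant.\<close>

lemma path_max_recursion: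
  assumes "m \<le> a" "m \<le> b"
  shows "path_max x u0 v0 (Suc m) (Suc a) (Suc b) + path_max x u0 v0 m a b =
    x (u0 + Suc a, v0 + Suc b) +
    (let p = path_max x u0 v0 (Suc m) a (Suc b) + path_max x u0 v0 m (Suc a) b;
         q = path_max x u0 v0 (Suc m) (Suc a) b + path_max x u0 v0 m a (Suc b)
     in if m < a \<and> m < b then max p q else if m < b then q else if m < a then p
        else path_max x u0 v0 m a (Suc b) + path_max x u0 v0 m (Suc a) b)"
    (is "?l = ?w + ?r")
proof -
  define d where "d = v0 + (b - m)"
  define D where "D = (\<lambda>\<theta> k a j. row_det (exp_weight u0 x \<theta>) v0 k a j)"
  have gr: "growth (\<lambda>\<theta>. D \<theta> k a' j) (path_max x u0 v0 k a' b')"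
    if "k \<le> a'" "k \<le> b'" "j = Suc v0 + (b' - k)" for k a' b' j
    unfolding D_def that(3) using that(1,2) by (rule growth_path_max)
  have gl: "growth (\<lambda>\<theta>. D \<theta> (Suc m) (Suc a) (Suc d) * D \<theta> m a (Suc d)) ?l"
    by (intro growth_mult gr) (use assms in \<open>simp_all add: d_def\<close>)
  have gw: "growth (\<lambda>\<theta>. exp_weight u0 x \<theta> (Suc a) (Suc d + m)) ?w"
    using growth_exp[of ?w] assms by (simp add: exp_weight_def d_def)
  let ?P = "\<lambda>\<theta>. D \<theta> (Suc m) a (Suc d) * D \<theta> m (Suc a) (Suc d)"
  let ?Q = "\<lambda>\<theta>. D \<theta> (Suc m) (Suc a) d * D \<theta> m a (Suc (Suc d))"
  let ?p = "path_max x u0 v0 (Suc m) a (Suc b) + path_max x u0 v0 m (Suc a) b"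
  let ?q = "path_max x u0 v0 (Suc m) (Suc a) b + path_max x u0 v0 m a (Suc b)"
  have P: "growth ?P ?p" if "m < a"
    by (intro growth_mult gr) (use assms that in \<open>simp_all add: d_def\<close>)
  have Q: "growth ?Q ?q" if "m < b"
    by (intro growth_mult gr) (use assms that in \<open>simp_all add: d_def\<close>)
  have P0: "D \<theta> (Suc m) a (Suc d) = 0" if "m = a" "m < b" for \<theta>
    using that by (simp add: D_def d_def row_det_eq_0_few_rows)
  have Q0: "D \<theta> (Suc m) (Suc a) d = 0" if "m = b" for \<theta>
    using that by (simp add: D_def d_def row_det_eq_0_left)
  have "growth (\<lambda>\<theta>. ?P \<theta> + ?Q \<theta>) ?r"
  proof -
    consider "m < a" "m < b" | "m = a" "m < b" | "m < a" "m = b" | "m = a" "m = b"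
      using assms by linarith
    then show ?thesis
    proof cases
      case 1
      then show ?thesis using growth_add[OF P Q] by simp
    next
      case 2
      then show ?thesis using Q P0 by simp
    next
      case 3
      then show ?thesis using P Q0 by simp
    next
      case 4
      \<comment> \<open>Both systems cover the rectangle of \<open>m\<close> rows and
        \<open>Suc m\<close> columns: one by vertical paths, the other because there are as many
        paths as rows.\<close>
      have "D \<theta> (Suc m) a (Suc d) = D \<theta> m a (Suc (Suc d))" for \<theta>
        using row_det_full_width[of "exp_weight u0 x \<theta>" v0 "Suc m" m]
          row_det_full_height[of "exp_weight u0 x \<theta>" v0 m 1] 4
        by (simp add: D_def d_def exp_weight_def)
      moreover have "growth (\<lambda>\<theta>. D \<theta> m a (Suc (Suc d)) * D \<theta> m (Suc a) (Suc d))
          (path_max x u0 v0 m a (Suc b) + path_max x u0 v0 m (Suc a) b)"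
        by (intro growth_mult gr) (use 4 in \<open>simp_all add: d_def\<close>)
      ultimately show ?thesis using Q0[OF 4(2)] 4 by simp
    qed
  qed
  from growth_mult[OF gw this]
  have "growth (\<lambda>\<theta>. D \<theta> (Suc m) (Suc a) (Suc d) * D \<theta> m a (Suc d)) (?w + ?r)"
    unfolding D_def row_det_recursion .
  then show ?thesis by (rule growth_unique[OF gl])
qed

text \<open>Growth rates of the Desnanot--Jacobi identity. If \<open>l = b\<close>, the first
  product has a sink to the left of all sources and vanishes. If \<open>Suc l = a\<close> and
  \<open>l < b\<close>, the second has more paths than rows and vanishes; if both equalities hold,
  its larger minor covers the full rectangle.\<close>

lemma path_max_dodgson:
  assumes "l \<le> b" "Suc l \<le> a"
  shows "path_max x u0 v0 (Suc l) a (Suc b) + path_max x u0 (Suc v0) (Suc l) a (Suc b) =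
    (let p = path_max x u0 (Suc v0) (Suc l) a b + path_max x u0 v0 (Suc l) a (Suc (Suc b));
         q = path_max x u0 v0 (Suc (Suc l)) a (Suc (Suc b)) + path_max x u0 (Suc v0) l a b
     in if l < b \<and> Suc l < a then max p q else if l < b then p else if Suc l < a then q
        else path_max x u0 (Suc v0) l a b + path_max x u0 v0 (Suc l) a (Suc (Suc b)))"
    (is "?l = ?r")
proof -
  define j where "j = Suc v0 + (b - l)"
  define D where "D = (\<lambda>\<theta> v k j. row_det (exp_weight u0 x \<theta>) v k a j)"
  have gr: "growth (\<lambda>\<theta>. D \<theta> v k j') (path_max x u0 v k a b')"
    if "k \<le> a" "k \<le> b'" "j' = Suc v + (b' - k)" for v k b' j'
    unfolding D_def that(3) using that(1,2) by (rule growth_path_max)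
  have gl: "growth (\<lambda>\<theta>. D \<theta> v0 (Suc l) j * D \<theta> (Suc v0) (Suc l) (Suc j)) ?l"
    by (intro growth_mult gr) (use assms in \<open>simp_all add: j_def\<close>)
  let ?P = "\<lambda>\<theta>. D \<theta> (Suc v0) (Suc l) j * D \<theta> v0 (Suc l) (Suc j)"
  let ?Q = "\<lambda>\<theta>. D \<theta> v0 (Suc (Suc l)) j * D \<theta> (Suc v0) l (Suc j)"
  let ?p = "path_max x u0 (Suc v0) (Suc l) a b + path_max x u0 v0 (Suc l) a (Suc (Suc b))"
  let ?q = "path_max x u0 v0 (Suc (Suc l)) a (Suc (Suc b)) + path_max x u0 (Suc v0) l a b"
  have P: "growth ?P ?p" if "l < b"
    by (intro growth_mult gr) (use assms that in \<open>simp_all add: j_def\<close>)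
  have Q: "growth ?Q ?q" if "Suc l < a"
    by (intro growth_mult gr) (use assms that in \<open>simp_all add: j_def\<close>)
  have P0: "D \<theta> (Suc v0) (Suc l) j = 0" if "l = b" for \<theta>
    using that by (simp add: D_def j_def row_det_eq_0_left)
  have Q0: "D \<theta> v0 (Suc (Suc l)) j = 0" if "Suc l = a" "l < b" for \<theta>
    using that by (simp add: D_def j_def row_det_eq_0_few_rows)
  have "growth (\<lambda>\<theta>. ?P \<theta> + ?Q \<theta>) ?r"
  proof -
    consider "l < b" "Suc l < a" | "l < b" "Suc l = a" | "l = b" "Suc l < a" | "l = b" "Suc l = a"
      using assms by linarith
    then show ?thesis
    proof cases
      case 1
      then show ?thesis using growth_add[OF P Q] by simp
    next
      case 2
      then show ?thesis using P Q0 by simp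
    next
      case 3
      then show ?thesis using Q P0 by simp
    next
      case 4
      have "D \<theta> v0 (Suc (Suc l)) j = D \<theta> v0 (Suc l) (Suc j)" for \<theta>
        using row_det_full_width[of "exp_weight u0 x \<theta>" v0 "Suc (Suc l)" "Suc l"]
          row_det_full_height[of "exp_weight u0 x \<theta>" v0 "Suc l" 1] 4
        by (simp add: D_def j_def exp_weight_def)
      moreover have "growth (\<lambda>\<theta>. D \<theta> v0 (Suc l) (Suc j) * D \<theta> (Suc v0) l (Suc j))
          (path_max x u0 v0 (Suc l) a (Suc (Suc b)) + path_max x u0 (Suc v0) l a b)"
        by (intro growth_mult gr) (use 4 in \<open>simp_all add: j_def\<close>)
      ultimately show ?thesis using P0[OF 4(1)] 4 by (simp add: add.commute)
    qed
  qed
  then have "growth (\<lambda>\<theta>. D \<theta> v0 (Suc l) j * D \<theta> (Suc v0) (Suc l) (Suc j)) ?r"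
    unfolding D_def row_det_dodgson .
  then show ?thesis by (rule growth_unique[OF gl])
qed

text \<open>\<open>H\<close> treats rows and columns differently, as all sources share a row. But
  transposition merely exchanges the terms \<open>p\<close> and \<open>q\<close> of the recursion,
  which fixes the values by induction on \<open>m\<close> and then on \<open>a + b\<close>.\<close>

lemma path_max_transpose:
  assumes "m \<le> a" "m \<le> b"
  shows "path_max x u0 v0 m a b = path_max (\<lambda>(i, j). x (j, i)) v0 u0 m b a"
  using assms
proof (induction m arbitrary: a b)
  case (Suc m)
  note IHm = Suc.IH
  show ?case using Suc.prems
  proof (induction "a + b" arbitrary: a b rule: less_induct)
    case less
    from less.prems obtain a' b' where ab: "a = Suc a'" "b = Suc b'" "m \<le> a'" "m \<le> b'"
      by (cases a; cases b) auto
    let ?y = "\<lambda>(i, j). x (j, i)"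
    have 1: "path_max x u0 v0 m a' b' = path_max ?y v0 u0 m b' a'"
      "path_max x u0 v0 m (Suc a') b' = path_max ?y v0 u0 m b' (Suc a')"
      "path_max x u0 v0 m a' (Suc b') = path_max ?y v0 u0 m (Suc b') a'"
      using ab by (auto intro!: IHm)
    have 2: "path_max x u0 v0 (Suc m) a' (Suc b') = path_max ?y v0 u0 (Suc m) (Suc b') a'" if "m < a'"
      using ab that by (auto intro!: less.hyps)
    have 3: "path_max x u0 v0 (Suc m) (Suc a') b' = path_max ?y v0 u0 (Suc m) b' (Suc a')" if "m < b'"
      using ab that by (auto intro!: less.hyps)
    show ?case
      using path_max_recursion[OF ab(3,4), of x u0 v0] path_max_recursion[OF ab(4,3), of ?y v0 u0] 1 2 3
      unfolding ab(1,2) Let_def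
      by (cases "m < a'"; cases "m < b'") (simp_all add: max.commute add.commute)
  qed
qed simp

section \<open>Shapes and the shift by one column\<close>

text \<open>The gain from one more path; in Greene's theorem, a part of the shape of the rectangle,
  with parts counted from 0.\<close>

definition shape ::
  "(nat \<times> nat \<Rightarrow> real) \<Rightarrow> nat \<Rightarrow> nat \<Rightarrow> nat \<Rightarrow> nat \<Rightarrow> nat \<Rightarrow> real" where
  "shape x u0 v0 m a b = path_max x u0 v0 (Suc m) a b - path_max x u0 v0 m a b"

lemma shape_transpose:
  assumes "m < a" "m < b"
  shows "shape (\<lambda>(i, j). x (j, i)) v0 u0 m b a = shape x u0 v0 m a b"
  using assms by (simp add: shape_def path_max_transpose[of _ a b])

text \<open>Last passage percolation, which is the recursion that inverts the transfer map.\<close>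

lemma shape_0:
  "shape x u0 v0 0 (Suc a) (Suc b) = x (u0 + Suc a, v0 + Suc b) +
     (if 0 < a \<and> 0 < b then max (shape x u0 v0 0 a (Suc b)) (shape x u0 v0 0 (Suc a) b)
      else if 0 < a then shape x u0 v0 0 a (Suc b)
      else if 0 < b then shape x u0 v0 0 (Suc a) b else 0)"
  using path_max_recursion[of 0 a b x u0 v0] by (simp add: shape_def Let_def)

lemma min_diff_real: "min (q - q0) (p - p0) = p + q - max (p + q0) (q + p0 :: real)"
  by (simp add: min_def max_def)

lemma max_diff_real: "max (p' - p) (q' - q) = max (p' + q) (q' + p) - p - (q :: real)"
  by (simp add: max_def)

text \<open>The difference of the recursions for \<open>Suc m\<close> and \<open>m\<close>, in which
  the label cancels. With part \<open>m\<close> of the rectangle \<open>a\<close> by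
  \<open>b\<close> placed at \<open>(a - m, b - m)\<close>, this is a toggle.\<close>

lemma shape_Suc:
  assumes "m < a" "m < b"
  shows "shape x u0 v0 (Suc m) (Suc a) (Suc b) =
    min (shape x u0 v0 m (Suc a) b) (shape x u0 v0 m a (Suc b)) +
    (if Suc m < a \<and> Suc m < b
     then max (shape x u0 v0 (Suc m) a (Suc b)) (shape x u0 v0 (Suc m) (Suc a) b)
     else if Suc m < a then shape x u0 v0 (Suc m) a (Suc b)
     else if Suc m < b then shape x u0 v0 (Suc m) (Suc a) b else 0) -
    shape x u0 v0 m a b"
proof -
  let ?p = "path_max x u0 v0"
  let ?w = "x (u0 + Suc a, v0 + Suc b)"
  have 0: "?p (Suc m) (Suc a) (Suc b) + ?p m a b =
      ?w + max (?p (Suc m) a (Suc b) + ?p m (Suc a) b) (?p (Suc m) (Suc a) b + ?p m a (Suc b))"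
    using path_max_recursion[of m a b x u0 v0] assms by simp
  let ?M = "if Suc m < a \<and> Suc m < b
     then max (?p (Suc (Suc m)) a (Suc b) - ?p (Suc m) a (Suc b))
              (?p (Suc (Suc m)) (Suc a) b - ?p (Suc m) (Suc a) b)
     else if Suc m < a then ?p (Suc (Suc m)) a (Suc b) - ?p (Suc m) a (Suc b)
     else if Suc m < b then ?p (Suc (Suc m)) (Suc a) b - ?p (Suc m) (Suc a) b else 0"
  have 1: "?p (Suc (Suc m)) (Suc a) (Suc b) + ?p (Suc m) a b =
      ?w + ?p (Suc m) a (Suc b) + ?p (Suc m) (Suc a) b + ?M"
    using path_max_recursion[of "Suc m" a b x u0 v0] assms
    by (cases "Suc m < a"; cases "Suc m < b") (simp_all add: Let_def max_diff_real)
  show ?thesis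
    unfolding shape_def min_diff_real using 0 1 by linarith
qed

text \<open>The difference of two consecutive Desnanot--Jacobi identities. With the shapes at offset
  \<open>v0\<close> as old labels and those at offset \<open>Suc v0\<close> as new ones, it is the
  toggle rule of a sweep.\<close>

lemma shape_dodgson:
  assumes "l \<le> b" "l < a"
  shows "shape x u0 v0 l a (Suc b) + shape x u0 (Suc v0) l a (Suc b) =
    (if 0 < l then min (shape x u0 (Suc v0) (l - 1) a b) (shape x u0 v0 l a (Suc (Suc b)))
     else shape x u0 v0 l a (Suc (Suc b))) +
    (if l < b \<and> Suc l < a
     then max (shape x u0 v0 (Suc l) a (Suc (Suc b))) (shape x u0 (Suc v0) l a b)
     else if Suc l < a then shape x u0 v0 (Suc l) a (Suc (Suc b))
     else if l < b then shape x u0 (Suc v0) l a b else 0)"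
proof -
  let ?p = "path_max x u0 v0" and ?q = "path_max x u0 (Suc v0)"
  let ?M = "if l < b \<and> Suc l < a
     then max (?p (Suc (Suc l)) a (Suc (Suc b)) - ?p (Suc l) a (Suc (Suc b)))
              (?q (Suc l) a b - ?q l a b)
     else if Suc l < a then ?p (Suc (Suc l)) a (Suc (Suc b)) - ?p (Suc l) a (Suc (Suc b))
     else if l < b then ?q (Suc l) a b - ?q l a b else 0"
  have 1: "?p (Suc l) a (Suc b) + ?q (Suc l) a (Suc b) = ?p (Suc l) a (Suc (Suc b)) + ?q l a b + ?M"
    using path_max_dodgson[of l b a x u0 v0] assms
    by (cases "l < b"; cases "Suc l < a")
       (simp_all add: Let_def max_diff_real max.commute add.commute)
  let ?N = "if 0 < l then min (?q (Suc (l - 1)) a b - ?q (l - 1) a b)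
                               (?p (Suc l) a (Suc (Suc b)) - ?p l a (Suc (Suc b)))
     else ?p (Suc l) a (Suc (Suc b)) - ?p l a (Suc (Suc b))"
  have 0: "?p l a (Suc b) + ?q l a (Suc b) + ?N = ?p (Suc l) a (Suc (Suc b)) + ?q l a b"
  proof (cases l)
    case (Suc n)
    then show ?thesis
      using path_max_dodgson[of n b a x u0 v0] assms
      by (simp add: min_diff_real add.commute)
  qed simp
  show ?thesis
    unfolding shape_def using 0 1 by linarith
qed

text \<open>\<open>min_mixed\<close> and \<open>max_mixed\<close> take one neighbour of a vertex from each of two labelings, with the
  boundary values of the toggles; this is how the labels look in the middle of a sweep.\<close>

definition min_mixed ::
  "nat \<Rightarrow> nat \<Rightarrow> (nat \<times> nat \<Rightarrow> real) \<Rightarrow> (nat \<times> nat \<Rightarrow> real) \<Rightarrow> nat \<times> nat \<Rightarrow> real" where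
  "min_mixed r s f g = (\<lambda>(i, j).
     if i < r \<and> j < s then min (f (Suc i, j)) (g (i, Suc j))
     else if i < r then f (Suc i, j) else if j < s then g (i, Suc j) else 1)"

definition max_mixed ::
  "(nat \<times> nat \<Rightarrow> real) \<Rightarrow> (nat \<times> nat \<Rightarrow> real) \<Rightarrow> nat \<times> nat \<Rightarrow> real" where
  "max_mixed f g = (\<lambda>(i, j).
     if 1 < i \<and> 1 < j then max (f (i - 1, j)) (g (i, j - 1))
     else if 1 < i then f (i - 1, j) else if 1 < j then g (i, j - 1) else 0)"

section \<open>Shifting column intervals by one\<close>

lemma path_max_eqI:
  assumes "\<And>l. l < k \<Longrightarrow> shape x u0 v0 l a b = shape x' u0' v0' l a b"
  shows "path_max x u0 v0 k a b = path_max x' u0' v0' k a b"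
  using assms
proof (induction k)
  case (Suc k)
  then show ?case using Suc.prems[of k] by (simp add: shape_def)
qed simp

text \<open>Along diagonals, \<open>y\<close> and \<open>z\<close> hold the shapes of
  \<open>x\<close> and \<open>x'\<close> on the first \<open>v\<close> columns. For
  \<open>u = 0\<close> the sweep rule and \<open>shape_dodgson\<close> are the same recursion, so
  \<open>z\<close> also holds the shapes of \<open>x\<close> on intervals starting at column 2. The
  Desnanot--Jacobi identity then carries the equality from one offset to the next.\<close>

lemma path_max_shift:
  fixes r s :: nat
  assumes y: "\<And>v m. v \<le> s \<Longrightarrow> m < r \<Longrightarrow> m < v \<Longrightarrow> y (r - m, v - m) = shape x 0 0 m r v"
    and z: "\<And>v m. v \<le> s \<Longrightarrow> m < r \<Longrightarrow> m < v \<Longrightarrow> z (r - m, v - m) = shape x' 0 0 m r v"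
    and yz: "\<And>i j. 1 \<le> i \<Longrightarrow> i \<le> r \<Longrightarrow> 1 \<le> j \<Longrightarrow> j \<le> s \<Longrightarrow> r + j < s + i \<Longrightarrow>
      z (i, j) = min_mixed r s z y (i, j) + max_mixed y z (i, j) - y (i, j)"
  shows "Suc u + b \<le> s \<Longrightarrow> k \<le> r \<Longrightarrow> k \<le> b \<Longrightarrow>
    path_max x 0 (Suc u) k r b = path_max x' 0 u k r b"
proof (induction u arbitrary: b k)
  case 0
  have z': "shape x 0 (Suc 0) l r b = z (r - l, b - l)" if "l < r" "l < b" "Suc b \<le> s" for l b
    using that
  proof (induction b arbitrary: l)
    case (Suc b)
    let ?i = "r - l" and ?j = "Suc b - l"
    have ij: "1 \<le> ?i" "?i \<le> r" "1 \<le> ?j" "?j \<le> s" "r + ?j < s + ?i" "?j < s" using Suc.prems by auto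
    have y1: "y (?i, ?j) = shape x 0 0 l r (Suc b)" using y[of "Suc b" l] Suc.prems by simp
    \<comment> \<open>The neighbours with old labels lie on the diagonal of width
      \<open>Suc (Suc b)\<close>, those with new labels on the diagonal of width \<open>b\<close>,
      which the induction covers.\<close>
    have y2: "y (?i, Suc ?j) = shape x 0 0 l r (Suc (Suc b))"
      using y[of "Suc (Suc b)" l] Suc.prems by (simp add: Suc_diff_le)
    have y3: "y (?i - 1, ?j) = shape x 0 0 (Suc l) r (Suc (Suc b))" if "Suc l < r"
      using y[of "Suc (Suc b)" "Suc l"] Suc.prems that by simp
    have z1: "z (Suc ?i, ?j) = shape x 0 (Suc 0) (l - 1) r b" if "0 < l"
    proof -
      have "Suc ?i = r - (l - 1)" "?j = b - (l - 1)" using that Suc.prems by auto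
      then show ?thesis using Suc.IH[of "l - 1"] Suc.prems that by simp
    qed
    have z2: "z (?i, ?j - 1) = shape x 0 (Suc 0) l r b" if "l < b"
      using Suc.IH[of l] Suc.prems that by simp
    have mn: "min_mixed r s z y (?i, ?j) =
        (if 0 < l then min (shape x 0 (Suc 0) (l - 1) r b) (shape x 0 0 l r (Suc (Suc b)))
         else shape x 0 0 l r (Suc (Suc b)))"
      using ij z1 y2 Suc.prems by (auto simp: min_mixed_def)
    have mx: "max_mixed y z (?i, ?j) =
       (if l < b \<and> Suc l < r
        then max (shape x 0 0 (Suc l) r (Suc (Suc b))) (shape x 0 (Suc 0) l r b)
        else if Suc l < r then shape x 0 0 (Suc l) r (Suc (Suc b))
        else if l < b then shape x 0 (Suc 0) l r b else 0)"
    proof -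
      have "1 < ?i \<longleftrightarrow> Suc l < r" "1 < ?j \<longleftrightarrow> l < b" by auto
      then show ?thesis unfolding max_mixed_def prod.case using y3 z2 by simp
    qed
    show ?case
    proof -
      have "l \<le> b" using Suc.prems by simp
      then show ?thesis
        using yz[OF ij(1-5)] shape_dodgson[of l b r x 0 0] Suc.prems(1) unfolding mn mx y1 by linarith
    qed
  qed simp
  show ?case
    by (rule path_max_eqI) (use 0 z z' in simp)
next
  case (Suc u)
  note IHu = Suc.IH
  show ?case using Suc.prems
  proof (induction b arbitrary: k)
    case (Suc b)
    note IHb = Suc.IH and prems = Suc.prems
    show ?case
    proof (cases k)
      case (Suc l)
      have l: "l \<le> b" "Suc l \<le> r" using Suc prems by simp_all
      \<comment> \<open>In the identity all terms but the desired one agree: by \<open>IHu\<close>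
        at the smaller offset, by \<open>IHb\<close> at the larger offset with width
        \<open>b\<close>.\<close>
      have A: "path_max x 0 (Suc u) (Suc l) r (Suc b) = path_max x' 0 u (Suc l) r (Suc b)"
        "path_max x 0 (Suc u) (Suc l) r (Suc (Suc b)) = path_max x' 0 u (Suc l) r (Suc (Suc b))"
        "path_max x 0 (Suc (Suc u)) l r b = path_max x' 0 (Suc u) l r b"
        using l prems by (auto intro!: IHu IHb)
      have D: "path_max x 0 (Suc u) (Suc (Suc l)) r (Suc (Suc b)) =
          path_max x' 0 u (Suc (Suc l)) r (Suc (Suc b))" if "Suc l < r"
        using l prems that by (auto intro!: IHu)
      have C: "path_max x 0 (Suc (Suc u)) (Suc l) r b = path_max x' 0 (Suc u) (Suc l) r b" if "l < b"
        using l prems that by (auto intro!: IHb)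
      show ?thesis
        using path_max_dodgson[OF l, of x 0 "Suc u"] path_max_dodgson[OF l, of x' 0 u] A C D
        unfolding Suc Let_def by (cases "l < b"; cases "Suc l < r") simp_all
    qed simp
  qed simp
qed

section \<open>Toggles, RSK and promotion\<close>

lemma covered_by_grid_iff:
  assumes "(i, j) \<in> grid r s"
  shows "covered_by (grid r s) (i, j) q \<longleftrightarrow> q = (Suc i, j) \<and> i < r \<or> q = (i, Suc j) \<and> j < s"
proof
  assume cov: "covered_by (grid r s) (i, j) q"
  obtain a b where q: "q = (a, b)" by (cases q)
  have ab: "(a, b) \<in> grid r s" "i \<le> a" "j \<le> b" "i < a \<or> j < b"
    using cov by (auto simp: covered_by_def q less_prod_def less_eq_prod_def)
  have no: "\<not> ((i, j) < z \<and> z < (a, b))" if "z \<in> grid r s" for z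
    using cov that by (auto simp: covered_by_def q)
  show "q = (Suc i, j) \<and> i < r \<or> q = (i, Suc j) \<and> j < s"
  proof (cases "i < a")
    case True
    then have "(Suc i, j) \<in> grid r s" using assms ab by (auto simp: grid_def)
    from no[OF this] show ?thesis
      using True ab by (auto simp: less_prod_def less_eq_prod_def grid_def q)
  next
    case False
    then have "(i, Suc j) \<in> grid r s" using assms ab by (auto simp: grid_def)
    from no[OF this] show ?thesis
      using False ab by (auto simp: less_prod_def less_eq_prod_def grid_def q)
  qed
next
  assume "q = (Suc i, j) \<and> i < r \<or> q = (i, Suc j) \<and> j < s"
  then show "covered_by (grid r s) (i, j) q"
    using assms by (auto simp: covered_by_def grid_def less_prod_def less_eq_prod_def)
qed

lemma covered_by_grid_iff':
  assumes "(i, j) \<in> grid r s"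
  shows "covered_by (grid r s) q (i, j) \<longleftrightarrow> q = (i - 1, j) \<and> 1 < i \<or> q = (i, j - 1) \<and> 1 < j"
proof (cases "q \<in> grid r s")
  case True
  obtain a b where q: "q = (a, b)" by (cases q)
  show ?thesis
    using assms covered_by_grid_iff[of a b r s "(i, j)"] True by (auto simp: q grid_def)
next
  case False
  then show ?thesis using assms by (auto simp: covered_by_def grid_def)
qed

lemma min_above_eq:
  assumes "p \<in> grid r s"
  shows "min_above r s x p = min_mixed r s x x p"
proof -
  obtain i j where p: "p = (i, j)" by (cases p)
  have "{q. covered_by (grid r s) p q} =
      (if i < r then {(Suc i, j)} else {}) \<union> (if j < s then {(i, Suc j)} else {})"
    using covered_by_grid_iff[of i j r s] assms by (auto simp: p)
  then show ?thesis by (auto simp: min_above_def min_mixed_def p Let_def)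
qed

lemma max_below_eq:
  assumes "p \<in> grid r s"
  shows "max_below r s x p = max_mixed x x p"
proof -
  obtain i j where p: "p = (i, j)" by (cases p)
  have "{q. covered_by (grid r s) q p} =
      (if 1 < i then {(i - 1, j)} else {}) \<union> (if 1 < j then {(i, j - 1)} else {})"
    using covered_by_grid_iff'[of i j r s] assms by (auto simp: p)
  then show ?thesis by (auto simp: max_below_def max_mixed_def p Let_def)
qed

lemma min_above_cong:
  assumes "\<And>q. p < q \<Longrightarrow> x q = x' q"
  shows "min_above r s x p = min_above r s x' p"
proof -
  have "x ` {q. covered_by (grid r s) p q} = x' ` {q. covered_by (grid r s) p q}"
    by (rule image_cong) (auto simp: covered_by_def assms)
  then show ?thesis by (simp add: min_above_def Let_def)
qed

lemma max_below_cong: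
  assumes "\<And>q. q < p \<Longrightarrow> x q = x' q"
  shows "max_below r s x p = max_below r s x' p"
proof -
  have "x ` {q. covered_by (grid r s) q p} = x' ` {q. covered_by (grid r s) q p}"
    by (rule image_cong) (auto simp: covered_by_def assms)
  then show ?thesis by (simp add: max_below_def Let_def)
qed

section \<open>Sweeps of toggles along linear extensions\<close>

lemma compose_list_Nil [simp]: "compose_list [] = id"
  by (simp add: compose_list_def)

lemma compose_list_Cons [simp]: "compose_list (f # fs) = f \<circ> compose_list fs"
  by (simp add: compose_list_def)

text \<open>The last toggle of the list acts first, and no later entry is below an earlier one. So
  when \<open>p\<close> is toggled, its upper neighbours are final and its lower ones still
  old.\<close>

lemma compose_toggles:
  fixes r s :: nat and y :: "nat \<times> nat \<Rightarrow> real"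
  assumes "sorted_wrt (\<lambda>p q. \<not> q \<le> p) ps"
  defines "z \<equiv> compose_list (map (toggle r s) ps) y"
  shows "z p = (if p \<in> set ps then min_above r s z p + max_below r s y p - y p else y p)"
  using assms(1) unfolding z_def
proof (induction ps arbitrary: p)
  case (Cons a ps)
  let ?z = "compose_list (map (toggle r s) ps) y"
  have IH: "?z p = (if p \<in> set ps then min_above r s ?z p + max_below r s y p - y p else y p)" for p
    using Cons by simp
  have a: "\<not> q \<le> a" if "q \<in> set ps" for q using Cons.prems that by simp
  then have a_notin: "a \<notin> set ps" by blast
  have T: "compose_list (map (toggle r s) (a # ps)) y =
      ?z(a := min_above r s ?z a + max_below r s ?z a - ?z a)"
    by (simp add: toggle_def)
  show ?case
  proof (cases "p = a")
    case True
    have "min_above r s (compose_list (map (toggle r s) (a # ps)) y) a = min_above r s ?z a"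
      unfolding T by (rule min_above_cong) auto
    moreover have "max_below r s ?z a = max_below r s y a"
    proof (rule max_below_cong)
      fix q assume "q < a"
      then have "q \<le> a" by (rule less_imp_le)
      then have "q \<notin> set ps" using a by blast
      then show "?z q = y q" using IH by simp
    qed
    moreover have "?z a = y a" using IH[of a] a_notin by simp
    ultimately show ?thesis unfolding True T by simp
  next
    case False
    have "min_above r s (compose_list (map (toggle r s) (a # ps)) y) p = min_above r s ?z p"
      if "p \<in> set ps"
      unfolding T by (rule min_above_cong) (use a[OF that] in auto)
    moreover have "compose_list (map (toggle r s) (a # ps)) y p = ?z p"
      unfolding T using False by simp
    ultimately show ?thesis using IH[of p] False by (cases "p \<in> set ps") simp_all
  qed
qed simp

text \<open>A maximal element receives the largest label.\<close>

lemma ex_linear_extension: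
  fixes I :: "'a :: order set"
  assumes "finite I"
  shows "\<exists>L. linear_extension I L"
  using assms
proof (induction "card I" arbitrary: I)
  case 0
  then have "linear_extension I (\<lambda>_. 0)" by (simp add: linear_extension_def bij_betw_def)
  then show ?case by blast
next
  case (Suc n)
  then have "I \<noteq> {}" by auto
  then obtain m where m: "m \<in> I" "\<forall>b\<in>I. m \<le> b \<longrightarrow> m = b"
    using finite_has_maximal[OF Suc.prems] by blast
  have n: "card (I - {m}) = n" using Suc m(1) by simp
  then obtain L where L: "linear_extension (I - {m}) L"
    using Suc.hyps(1)[of "I - {m}"] Suc.prems by auto
  have bij: "bij_betw L (I - {m}) {1..n}"
    using L n by (simp add: linear_extension_def)
  then have le: "L p \<le> n" if "p \<in> I" "p \<noteq> m" for p
    using that by (auto simp: bij_betw_def)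
  have "bij_betw (L(m := Suc n)) (insert m (I - {m})) (insert (Suc n) {1..n})"
    by (rule bij_betw_combine[of _ "{m}" "{Suc n}", simplified])
       (use bij in \<open>auto simp: bij_betw_def inj_on_def\<close>)
  moreover have "insert m (I - {m}) = I" "insert (Suc n) {1..n} = {1..card I}"
    using m(1) Suc.hyps(2) by auto
  ultimately have "bij_betw (L(m := Suc n)) I {1..card I}" by simp
  moreover have "(L(m := Suc n)) p \<le> (L(m := Suc n)) q" if "p \<in> I" "q \<in> I" "p \<le> q" for p q
    using that m L le[of p] by (auto simp: linear_extension_def)
  ultimately show ?case unfolding linear_extension_def by blast
qed

lemma rho_eq_compose:
  assumes "finite I"
  obtains ps where "rho r s I = compose_list (map (toggle r s) ps)"
    and "sorted_wrt (\<lambda>p q. \<not> q \<le> p) ps" and "set ps = I"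
proof -
  define L where "L = (SOME L. linear_extension I L)"
  have L: "linear_extension I L"
    unfolding L_def using ex_linear_extension[OF assms] by (rule someI_ex)
  then have bij: "bij_betw L I {1..card I}" by (simp add: linear_extension_def)
  let ?f = "inv_into I L"
  have f: "?f k \<in> I" "L (?f k) = k" if "k \<in> {1..card I}" for k
    using bij that by (auto simp: bij_betw_def inv_into_into f_inv_into_f)
  show ?thesis
  proof (rule that[of "map ?f [1..<Suc (card I)]"])
    show "rho r s I = compose_list (map (toggle r s) (map ?f [1..<Suc (card I)]))"
      by (simp add: rho_def L_def Let_def o_def del: upt_Suc)
    show "sorted_wrt (\<lambda>p q. \<not> q \<le> p) (map ?f [1..<Suc (card I)])"
      unfolding sorted_wrt_map
    proof (rule sorted_wrt_mono_rel[OF _ sorted_wrt_upt])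
      fix k l assume kl: "k \<in> set [1..<Suc (card I)]" "l \<in> set [1..<Suc (card I)]" "k < l"
      then show "\<not> ?f l \<le> ?f k"
        using L f[of k] f[of l] unfolding linear_extension_def by fastforce
    qed
    show "set (map ?f [1..<Suc (card I)]) = I"
      using bij_betw_imp_surj_on[OF bij_betw_inv_into[OF bij]]
      by (simp add: atLeastLessThanSuc_atLeastAtMost del: upt_Suc)
  qed
qed

text \<open>The chosen linear extension has disappeared: this equation determines the result from
  the top of the poset downwards.\<close>

lemma rho_apply:
  assumes "finite I"
  shows "rho r s I y p =
    (if p \<in> I then min_above r s (rho r s I y) p + max_below r s y p - y p else y p)"
proof -
  obtain ps where ps: "rho r s I = compose_list (map (toggle r s) ps)"
    "sorted_wrt (\<lambda>p q. \<not> q \<le> p) ps" "set ps = I"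
    using rho_eq_compose[OF assms] .
  show ?thesis
    using compose_toggles[OF ps(2), of r s y p] unfolding ps(1) ps(3) .
qed

lemma toggle_bij:
  assumes "p \<in> grid r s"
  shows "bij_betw (toggle r s p) (labelings r s) (labelings r s)"
proof (rule bij_betw_byWitness[where f' = "toggle r s p"])
  \<comment> \<open>The label at \<open>p\<close> enters neither the minimum nor the maximum at
    \<open>p\<close>, so a toggle is an involution.\<close>
  have "toggle r s p (toggle r s p x) = x" for x
  proof -
    have "min_above r s (toggle r s p x) p = min_above r s x p"
      "max_below r s (toggle r s p x) p = max_below r s x p"
      by (auto intro!: min_above_cong max_below_cong simp: toggle_def)
    then show ?thesis by (simp add: toggle_def fun_upd_def fun_eq_iff)
  qed
  then show "\<forall>x\<in>labelings r s. toggle r s p (toggle r s p x) = x"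
    "\<forall>x\<in>labelings r s. toggle r s p (toggle r s p x) = x" by blast+
  have "toggle r s p x \<in> labelings r s" if "x \<in> labelings r s" for x
    using that assms by (auto simp: toggle_def labelings_def PiE_def extensional_def)
  then show "toggle r s p ` labelings r s \<subseteq> labelings r s"
    "toggle r s p ` labelings r s \<subseteq> labelings r s" by blast+
qed

lemma compose_list_bij:
  assumes "\<And>f. f \<in> set fs \<Longrightarrow> bij_betw f A A"
  shows "bij_betw (compose_list fs) A A"
  using assms by (induction fs) (auto intro: bij_betw_trans)

lemma finite_grid [simp]: "finite (grid r s)"
  by (simp add: grid_def)

lemma rho_bij:
  assumes "I \<subseteq> grid r s"
  shows "bij_betw (rho r s I) (labelings r s) (labelings r s)"
proof -
  have "finite I" using assms finite_grid by (rule finite_subset)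
  then obtain ps where "rho r s I = compose_list (map (toggle r s) ps)" "set ps = I"
    by (rule rho_eq_compose)
  then show ?thesis
    using assms by (auto intro!: compose_list_bij toggle_bij)
qed

text \<open>The labels after the first \<open>m\<close> steps \<open>\<rho>\<^bsub>r-1,s-1\<^esub>\<^sup>-\<^sup>1, \<dots>, \<rho>\<^bsub>r-m,s-m\<^esub>\<^sup>-\<^sup>1\<close> of \<open>RSK\<close>.\<close>

definition rsk_stage :: "nat \<Rightarrow> nat \<Rightarrow> (nat \<times> nat \<Rightarrow> real) \<Rightarrow> nat \<Rightarrow> nat \<times> nat \<Rightarrow> real" where
  "rsk_stage r s x m = (\<lambda>(i, j) \<in> grid r s.
     let d = min m (min (r - i) (s - j)) in shape x 0 0 d (i + d) (j + d))"

lemma rsk_stage_in_labelings: "rsk_stage r s x m \<in> labelings r s"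
  by (simp add: rsk_stage_def labelings_def)

lemma rsk_stage_apply:
  "1 \<le> i \<Longrightarrow> i \<le> r \<Longrightarrow> 1 \<le> j \<Longrightarrow> j \<le> s \<Longrightarrow> d = min m (min (r - i) (s - j)) \<Longrightarrow>
   rsk_stage r s x m (i, j) = shape x 0 0 d (i + d) (j + d)"
  by (simp add: rsk_stage_def grid_def Let_def)

lemma max_mixed_cong:
  assumes "1 < i \<Longrightarrow> f (i - 1, j) = f' (i - 1, j)" "1 < j \<Longrightarrow> g (i, j - 1) = g' (i, j - 1)"
  shows "max_mixed f g (i, j) = max_mixed f' g' (i, j)"
  using assms by (auto simp: max_mixed_def)

lemma min_mixed_cong:
  assumes "i < r \<Longrightarrow> f (Suc i, j) = f' (Suc i, j)" "j < s \<Longrightarrow> g (i, Suc j) = g' (i, Suc j)"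
  shows "min_mixed r s f g (i, j) = min_mixed r s f' g' (i, j)"
  using assms by (auto simp: min_mixed_def)

lemma labelings_eqI:
  assumes "y \<in> labelings r s" "z \<in> labelings r s"
    and "\<And>i j. 1 \<le> i \<Longrightarrow> i \<le> r \<Longrightarrow> 1 \<le> j \<Longrightarrow> j \<le> s \<Longrightarrow> y (i, j) = z (i, j)"
  shows "y = z"
  using assms(1,2) unfolding labelings_def
  by (rule PiE_ext) (use assms(3) in \<open>auto simp: grid_def\<close>)

section \<open>Greene's theorem for the toggle form of RSK\<close>

lemma transfer_inj: "inj_on (transfer r s) (labelings r s)"
proof (rule inj_onI)
  fix y z assume yz: "y \<in> labelings r s" "z \<in> labelings r s" "transfer r s y = transfer r s z"
  have "y (i, j) = z (i, j)" if "(i, j) \<in> grid r s" for i j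
    using that
  proof (induction "i + j" arbitrary: i j rule: less_induct)
    case less
    have "max_mixed y y (i, j) = max_mixed z z (i, j)"
      using less by (intro max_mixed_cong less.hyps) (auto simp: grid_def)
    moreover have "transfer r s y (i, j) = transfer r s z (i, j)" using yz(3) by simp
    ultimately show ?case using less.prems by (simp add: transfer_def max_below_eq)
  qed
  then show "y = z" using yz(1,2) by (intro labelings_eqI) (auto simp: grid_def)
qed

lemma transfer_rsk_stage:
  assumes "x \<in> labelings r s"
  shows "transfer r s (rsk_stage r s x 0) = x"
proof (rule labelings_eqI)
  fix i j assume ij: "1 \<le> i" "i \<le> r" "1 \<le> j" "j \<le> s"
  then obtain a b where ab: "i = Suc a" "j = Suc b" by (metis One_nat_def Suc_le_D)
  have st: "rsk_stage r s x 0 (i', j') = shape x 0 0 0 i' j'"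
    if "1 \<le> i'" "i' \<le> r" "1 \<le> j'" "j' \<le> s" for i' j'
    using rsk_stage_apply[OF that, of 0 0] by simp
  have "max_mixed (rsk_stage r s x 0) (rsk_stage r s x 0) (i, j) =
      (if 0 < a \<and> 0 < b then max (shape x 0 0 0 a (Suc b)) (shape x 0 0 0 (Suc a) b)
      else if 0 < a then shape x 0 0 0 a (Suc b)
      else if 0 < b then shape x 0 0 0 (Suc a) b else 0)"
    using ij by (auto simp: max_mixed_def ab st)
  then show "transfer r s (rsk_stage r s x 0) (i, j) = x (i, j)"
    using ij shape_0[of x 0 0 a b] st[OF ij]
    by (simp add: transfer_def grid_def max_below_eq ab)
qed (use assms in \<open>simp_all add: transfer_def labelings_def\<close>)

text \<open>\<open>RSK\<close> applies the inverse of \<open>rho\<close>, so its step is checked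
  backwards. By \<open>shape_Suc\<close> the two stages satisfy the equation of
  \<open>rho_apply\<close>.\<close>

lemma rho_rsk_stage:
  fixes r s m :: nat
  assumes "Suc m < min r s"
  defines "I \<equiv> grid (r - Suc m) (s - Suc m)"
  shows "rho r s I (rsk_stage r s x (Suc m)) = rsk_stage r s x m"
proof -
  let ?y = "rsk_stage r s x (Suc m)" and ?z = "rsk_stage r s x m"
  have I: "finite I" "I \<subseteq> grid r s" by (auto simp: I_def grid_def)
  have lab: "rho r s I ?y \<in> labelings r s"
    using bij_betwE[OF rho_bij[OF I(2)]] rsk_stage_in_labelings by blast
  have ap: "rsk_stage r s x k (i, j) = shape x 0 0 (min k (min (r - i) (s - j)))
      (i + min k (min (r - i) (s - j))) (j + min k (min (r - i) (s - j)))"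
    if "(i, j) \<in> grid r s" for k i j
    using that by (intro rsk_stage_apply) (auto simp: grid_def)
  \<comment> \<open>Outside \<open>I\<close> the diagonal reaches the boundary within
    \<open>m\<close> steps, so both stages read the same shape.\<close>
  have off: "?y p = ?z p" if "p \<notin> I" for p
  proof (cases "p \<in> grid r s")
    case True
    obtain i j where p: "p = (i, j)" by (cases p)
    have "min (Suc m) (min (r - i) (s - j)) = min m (min (r - i) (s - j))"
      using that True assms(1) by (auto simp: p I_def grid_def)
    then show ?thesis using ap True by (simp add: p)
  next
    case False
    then show ?thesis by (simp add: rsk_stage_def)
  qed
  have "rho r s I ?y (i, j) = ?z (i, j)" if "(i, j) \<in> grid r s" for i j
    using that
  \<comment> \<open>From the top down, because the new labels of the upper neighbours enter the
    equation.\<close>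
  proof (induction "r + s - (i + j)" arbitrary: i j rule: less_induct)
    case less
    show ?case
    proof (cases "(i, j) \<in> I")
      case False
      then show ?thesis using rho_apply[OF I(1), of r s ?y "(i, j)"] off by simp
    next
      case True
      then have ij: "1 \<le> i" "i + Suc m \<le> r" "1 \<le> j" "j + Suc m \<le> s"
        using assms(1) by (auto simp: I_def grid_def)
      have z0: "?z (i', j') = shape x 0 0 m (i' + m) (j' + m)"
        if "1 \<le> i'" "i' + m \<le> r" "1 \<le> j'" "j' + m \<le> s" for i' j'
        using that by (intro rsk_stage_apply) auto
      have y0: "?y (i', j') = shape x 0 0 (Suc m) (i' + Suc m) (j' + Suc m)"
        if "1 \<le> i'" "i' + Suc m \<le> r" "1 \<le> j'" "j' + Suc m \<le> s" for i' j'
        using that by (intro rsk_stage_apply) auto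
      have "min_mixed r s (rho r s I ?y) (rho r s I ?y) (i, j) = min_mixed r s ?z ?z (i, j)"
        using less.prems by (intro min_mixed_cong less.hyps) (auto simp: grid_def)
      also have "\<dots> = min (shape x 0 0 m (Suc (i + m)) (j + m)) (shape x 0 0 m (i + m) (Suc (j + m)))"
        using ij z0[of "Suc i" j] z0[of i "Suc j"] by (simp add: min_mixed_def)
      finally have mn: "min_mixed r s (rho r s I ?y) (rho r s I ?y) (i, j) =
          min (shape x 0 0 m (Suc (i + m)) (j + m)) (shape x 0 0 m (i + m) (Suc (j + m)))" .
      have mx: "max_mixed ?y ?y (i, j) =
          (if Suc m < i + m \<and> Suc m < j + m
           then max (shape x 0 0 (Suc m) (i + m) (Suc (j + m))) (shape x 0 0 (Suc m) (Suc (i + m)) (j + m))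
           else if Suc m < i + m then shape x 0 0 (Suc m) (i + m) (Suc (j + m))
           else if Suc m < j + m then shape x 0 0 (Suc m) (Suc (i + m)) (j + m) else 0)"
        using ij y0[of "i - 1" j] y0[of i "j - 1"] by (auto simp: max_mixed_def)
      have "rho r s I ?y (i, j) =
          min_mixed r s (rho r s I ?y) (rho r s I ?y) (i, j) + max_mixed ?y ?y (i, j) - ?y (i, j)"
        using rho_apply[OF I(1), of r s ?y "(i, j)"] True less.prems
        by (simp add: min_above_eq max_below_eq)
      then show ?thesis
        using shape_Suc[of m "i + m" "j + m" x 0 0] ij y0[of i j] z0[of i j]
        unfolding mn mx by simp
    qed
  qed
  then show ?thesis
    using lab rsk_stage_in_labelings by (intro labelings_eqI) (auto simp: grid_def)
qed

lemma RSK_eq_rsk_stage: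
  assumes "x \<in> labelings r s"
  shows "RSK r s x = rsk_stage r s x (min r s - 1)"
proof -
  let ?f = "\<lambda>k. inv_into (labelings r s) (rho r s (grid (r - k) (s - k)))"
  have t: "inv_into (labelings r s) (transfer r s) x = rsk_stage r s x 0"
    using inv_into_f_f[OF transfer_inj rsk_stage_in_labelings[of r s x 0]] transfer_rsk_stage[OF assms]
    by simp
  \<comment> \<open>The reversed list lets index 1 act first. The alternative \<open>m = 0\<close>
    includes a grid with an empty side.\<close>
  have "compose_list (map ?f (rev [1..<Suc m])) (rsk_stage r s x 0) = rsk_stage r s x m"
    if "m < min r s \<or> m = 0" for m
    using that
  proof (induction m)
    case (Suc m)
    have "grid (r - Suc m) (s - Suc m) \<subseteq> grid r s" by (auto simp: grid_def)
    then have "inj_on (rho r s (grid (r - Suc m) (s - Suc m))) (labelings r s)"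
      using rho_bij bij_betw_imp_inj_on by blast
    from inv_into_f_f[OF this rsk_stage_in_labelings[of r s x "Suc m"]]
    have "?f (Suc m) (rsk_stage r s x m) = rsk_stage r s x (Suc m)"
      using rho_rsk_stage[of m r s x] Suc.prems by simp
    then show ?case using Suc by simp
  qed simp
  from this[of "min r s - 1"]
  have "compose_list (map ?f (rev [1..<min r s])) (rsk_stage r s x 0) = rsk_stage r s x (min r s - 1)"
    by (cases "min r s") auto
  then show ?thesis by (simp add: RSK_def t)
qed

text \<open>The diagonal through \<open>(i, j)\<close> meets the last row or column at
  \<open>(i + d, j + d)\<close>, the corner of the rectangle whose shape is read; \<open>d\<close>
  is also the index of the part.\<close>

lemma RSK_apply:
  assumes "x \<in> labelings r s" "1 \<le> i" "i \<le> r" "1 \<le> j" "j \<le> s" "d = min (r - i) (s - j)"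
  shows "RSK r s x (i, j) = shape x 0 0 d (i + d) (j + d)"
  unfolding RSK_eq_rsk_stage[OF assms(1)]
  by (rule rsk_stage_apply) (use assms in auto)

lemma RSK_bij: "bij_betw (RSK r s) (labelings r s) (labelings r s)"
proof -
  have "transfer r s ` labelings r s = labelings r s"
  proof
    show "transfer r s ` labelings r s \<subseteq> labelings r s"
      by (auto simp: transfer_def labelings_def)
    show "labelings r s \<subseteq> transfer r s ` labelings r s"
      using transfer_rsk_stage rsk_stage_in_labelings by (metis image_eqI subsetI)
  qed
  then have "bij_betw (inv_into (labelings r s) (transfer r s)) (labelings r s) (labelings r s)"
    using transfer_inj bij_betw_inv_into by (metis bij_betw_def)
  moreover have "bij_betw (compose_list (map (\<lambda>k. inv_into (labelings r s) (rho r s (grid (r - k) (s - k))))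
      (rev [1..<min r s]))) (labelings r s) (labelings r s)"
    by (rule compose_list_bij) (auto intro!: bij_betw_inv_into rho_bij simp: grid_def)
  ultimately show ?thesis unfolding RSK_def by (rule bij_betw_trans)
qed

section \<open>Promotion as a sweep over the files\<close>

lemma grid_file_subset: "grid_file r s k \<subseteq> grid r s"
  by (auto simp: grid_file_def)

lemma SWPro_in_labelings:
  assumes "y \<in> labelings r s"
  shows "SWPro r s y \<in> labelings r s"
proof -
  have "bij_betw (SWPro r s) (labelings r s) (labelings r s)"
    unfolding SWPro_def by (rule compose_list_bij) (auto intro!: rho_bij grid_file_subset)
  then show ?thesis using assms by (rule bij_betwE[THEN bspec])
qed

text \<open>Files are toggled in decreasing order of \<open>i - j\<close>. The neighbours
  \<open>(i + 1, j)\<close> and \<open>(i, j - 1)\<close> lie in the preceding file and are new;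
  \<open>(i - 1, j)\<close> and \<open>(i, j + 1)\<close> lie in the following one and are
  old.\<close>

lemma SWPro_apply:
  fixes r s :: nat and y :: "nat \<times> nat \<Rightarrow> real"
  assumes "(i, j) \<in> grid r s"
  defines "z \<equiv> SWPro r s y"
  shows "z (i, j) = min_mixed r s z y (i, j) + max_mixed y z (i, j) - y (i, j)"
proof -
  \<comment> \<open>\<open>Z k\<close> is the labeling after the files from \<open>r - 1\<close>
    down to \<open>k\<close>.\<close>
  define Z where "Z = (\<lambda>k. compose_list (map (\<lambda>k. rho r s (grid_file r s k)) [k..int r - 1]) y)"
  have main: "Z (int r - int n) (i, j) =
    (if int r - int n \<le> int i - int j
     then min_mixed r s (Z (int r - int n)) y (i, j) + max_mixed y (Z (int r - int n)) (i, j) - y (i, j)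
     else y (i, j))"
    if "(i, j) \<in> grid r s" for n i j
    using that
  proof (induction n arbitrary: i j)
    case 0
    then show ?case by (simp add: Z_def grid_def)
  next
    case (Suc n)
    define k where "k = int r - int (Suc n)"
    have k1: "int r - int n = k + 1" by (simp add: k_def)
    note IH = Suc.IH[unfolded k1] and ij = Suc.prems
    have "[k..int r - 1] = k # [k + 1..int r - 1]" by (rule upto_rec1) (simp add: k_def)
    then have Zk: "Z k = rho r s (grid_file r s k) (Z (k + 1))" by (simp add: Z_def)
    have fin: "finite (grid_file r s k)"
      using grid_file_subset finite_grid by (rule finite_subset)
    note ra = rho_apply[OF fin, of r s "Z (k + 1)", folded Zk]
    have other: "Z k (i', j') = Z (k + 1) (i', j')" if "int i' - int j' \<noteq> k" for i' j'
      using ra[of "(i', j')"] that by (simp add: grid_file_def)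
    have old: "Z (k + 1) (i', j') = y (i', j')" if "(i', j') \<in> grid r s" "int i' - int j' \<le> k" for i' j'
      using IH[OF that(1)] that(2) by simp
    have "Z k (i, j) =
      (if k \<le> int i - int j then min_mixed r s (Z k) y (i, j) + max_mixed y (Z k) (i, j) - y (i, j)
       else y (i, j))"
    proof (cases "int i - int j = k")
      case True
      then have "(i, j) \<in> grid_file r s k" using ij by (simp add: grid_file_def)
      then have "Z k (i, j) = min_mixed r s (Z k) (Z k) (i, j) +
          max_mixed (Z (k + 1)) (Z (k + 1)) (i, j) - Z (k + 1) (i, j)"
        using ra[of "(i, j)"] ij by (simp add: min_above_eq max_below_eq)
      also have "min_mixed r s (Z k) (Z k) (i, j) = min_mixed r s (Z k) y (i, j)"
      proof (rule min_mixed_cong)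
        show "Z k (i, Suc j) = y (i, Suc j)" if "j < s"
          using other[of i "Suc j"] old[of i "Suc j"] ij True that by (simp add: grid_def)
      qed simp
      also have "max_mixed (Z (k + 1)) (Z (k + 1)) (i, j) = max_mixed y (Z k) (i, j)"
      proof (rule max_mixed_cong)
        show "Z (k + 1) (i - 1, j) = y (i - 1, j)" if "1 < i"
        proof (rule old)
          show "(i - 1, j) \<in> grid r s" using ij that by (auto simp: grid_def)
          show "int (i - 1) - int j \<le> k" using True by linarith
        qed
        show "Z (k + 1) (i, j - 1) = Z k (i, j - 1)" if "1 < j"
          using other[of i "j - 1"] True that by simp
      qed
      also have "Z (k + 1) (i, j) = y (i, j)" using old ij True by simp
      finally show ?thesis using True by simp
    next
      case False
      have "min_mixed r s (Z k) y (i, j) = min_mixed r s (Z (k + 1)) y (i, j)"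
        "max_mixed y (Z k) (i, j) = max_mixed y (Z (k + 1)) (i, j)" if "k < int i - int j"
        using ij that other by (auto intro!: min_mixed_cong max_mixed_cong simp: grid_def of_nat_diff)
      then show ?thesis using IH[OF ij] other[OF False] False by simp
    qed
    then show ?case by (simp add: k_def)
  qed
  have "int r - int (r + s - 1) = 1 - int s" using assms(1) by (auto simp: grid_def)
  then have Zz: "Z (int r - int (r + s - 1)) = z" by (simp add: z_def SWPro_def Z_def)
  have "int r - int (r + s - 1) \<le> int i - int j" using assms(1) by (auto simp: grid_def)
  then show ?thesis using main[OF assms(1), of "r + s - 1"] unfolding Zz by simp
qed

lemma H_eq_path_max:
  assumes "1 \<le> u1" "1 \<le> v1" "u1 \<le> u2" "v1 \<le> v2"
  shows "H u1 v1 u2 v2 x k =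
    path_max x (u1 - 1) (v1 - 1) (min k (min (u2 - u1 + 1) (v2 - v1 + 1)))
      (u2 - (u1 - 1)) (v2 - (v1 - 1))"
  using assms by (simp add: path_max_def H_def Let_def Suc_diff_le)

theorem lemma5p6:
  fixes r s k :: nat and x :: "nat \<times> nat \<Rightarrow> real"
  assumes "r \<ge> 1" and "s \<ge> 1" and "x \<in> labelings r s"
  shows
    "(\<forall>u v. 2 \<le> u \<and> u \<le> v \<and> v \<le> s \<longrightarrow>
        H 1 u r v x k = H 1 (u - 1) r (v - 1) ((RSK_inv r s \<circ> SWPro r s \<circ> RSK r s) x) k) \<and>
     (\<forall>u v. 1 \<le> u \<and> u \<le> v \<and> v \<le> r - 1 \<longrightarrow>
        H u 1 v s x k = H (u + 1) 1 (v + 1) s ((RSK_inv r s \<circ> SWPro r s \<circ> RSK r s) x) k)"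
proof -
  define y where "y = RSK r s x"
  define z where "z = SWPro r s y"
  define x' where "x' = RSK_inv r s z"
  have x'_eq: "(RSK_inv r s \<circ> SWPro r s \<circ> RSK r s) x = x'"
    by (simp add: x'_def z_def y_def)
  have "y \<in> labelings r s"
    unfolding y_def using bij_betwE[OF RSK_bij] assms(3) by blast
  then have z: "z \<in> RSK r s ` labelings r s"
    unfolding z_def using SWPro_in_labelings RSK_bij bij_betw_imp_surj_on by blast
  have x': "x' \<in> labelings r s" "RSK r s x' = z"
    unfolding x'_def RSK_inv_def by (rule inv_into_into[OF z], rule f_inv_into_f[OF z])
  have yz: "z (i, j) = min_mixed r s z y (i, j) + max_mixed y z (i, j) - y (i, j)"
    if "1 \<le> i" "i \<le> r" "1 \<le> j" "j \<le> s" for i j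
    unfolding z_def by (rule SWPro_apply) (use that in \<open>simp add: grid_def\<close>)
  \<comment> \<open>Diagonals ending in the last row give the shapes of the first \<open>v\<close>
    columns, those ending in the last column the shapes of the first \<open>u\<close> rows.\<close>
  have right: "RSK r s w (r - m, v - m) = shape w 0 0 m r v"
    if "w \<in> labelings r s" "v \<le> s" "m < r" "m < v" for w v m
    using RSK_apply[OF that(1), of "r - m" "v - m" m] that by simp
  have bottom: "RSK r s w (u - m, s - m) = shape w 0 0 m u s"
    if "w \<in> labelings r s" "u \<le> r" "m < s" "m < u" for w u m
    using RSK_apply[OF that(1), of "u - m" "s - m" m] that by simp
  let ?t = "\<lambda>f :: nat \<times> nat \<Rightarrow> real. \<lambda>(i, j). f (j, i)"
  have a: "path_max x 0 (Suc u) l r b = path_max x' 0 u l r b"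
    if "Suc u + b \<le> s" "l \<le> r" "l \<le> b" for u l b
  proof (rule path_max_shift[of s r y x z x'])
    show "y (r - m, v - m) = shape x 0 0 m r v" if "v \<le> s" "m < r" "m < v" for v m
      unfolding y_def by (rule right[OF assms(3) that])
    show "z (r - m, v - m) = shape x' 0 0 m r v" if "v \<le> s" "m < r" "m < v" for v m
      using right[OF x'(1) that] by (simp only: x'(2))
  qed (use that yz in auto)
  have b: "path_max x u 0 l b s = path_max x' (Suc u) 0 l b s"
    if "Suc u + b \<le> r" "l \<le> s" "l \<le> b" for u l b
  proof -
    \<comment> \<open>Transposition exchanges the neighbours with old and with new labels. The sweep
      rule thus holds for the transposes with \<open>z\<close> as old and \<open>y\<close> as new
      labeling, and \<open>x'\<close> and \<open>x\<close> trade places.\<close>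
    have "path_max (?t x') 0 (Suc u) l s b = path_max (?t x) 0 u l s b"
    proof (rule path_max_shift[of r s "?t z" "?t x'" "?t y" "?t x"])
      show "?t z (s - m, v - m) = shape (?t x') 0 0 m s v" if "v \<le> r" "m < s" "m < v" for v m
        using bottom[OF x'(1) that] that by (simp add: x'(2) shape_transpose)
      show "?t y (s - m, v - m) = shape (?t x) 0 0 m s v" if "v \<le> r" "m < s" "m < v" for v m
        using bottom[OF assms(3) that] that by (simp add: y_def shape_transpose)
      show "?t y (j, i) = min_mixed s r (?t y) (?t z) (j, i) + max_mixed (?t z) (?t y) (j, i) - ?t z (j, i)"
        if "1 \<le> j" "j \<le> s" "1 \<le> i" "i \<le> r" for j i
      proof -
        have "min_mixed s r (?t y) (?t z) (j, i) = min_mixed r s z y (i, j)"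
          "max_mixed (?t z) (?t y) (j, i) = max_mixed y z (i, j)"
          by (auto simp: min_mixed_def max_mixed_def min.commute max.commute)
        then show ?thesis using yz[of i j] that by simp
      qed
    qed (use that in auto)
    then show ?thesis
      using that path_max_transpose[of l b s x u 0] path_max_transpose[of l b s x' "Suc u" 0] by simp
  qed
  show ?thesis
    unfolding x'_eq
  proof (intro conjI allI impI; elim conjE)
    fix u v assume uv: "2 \<le> u" "u \<le> v" "v \<le> s"
    \<comment> \<open>Columns \<open>u\<close> to \<open>v\<close> have offset \<open>u - 1\<close>,
      which is a successor in fact \<open>a\<close>; hence \<open>u - 2\<close>. The number of paths
      is capped as in \<open>H\<close>.\<close>
    then show "H 1 u r v x k = H 1 (u - 1) r (v - 1) x' k"
      using a[of "u - 2" "v - (u - 1)" "min k (min r (v - u + 1))"] assms(1)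
      by (simp add: H_eq_path_max numeral_2_eq_2 Suc_diff_Suc Suc_diff_le)
  next
    fix u v assume uv: "1 \<le> u" "u \<le> v" "v \<le> r - 1"
    then show "H u 1 v s x k = H (u + 1) 1 (v + 1) s x' k"
      using b[of "u - 1" "v - (u - 1)" "min k (min (v - u + 1) s)"] assms(2)
      by (simp add: H_eq_path_max)
  qed
qed

end
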